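(* Let $(N,\sigma)$ be a smooth finite dimensional symplectic manifold, let $A$ be its algebra of smooth real functions, let $L$ be the $(\mathbb R,A)$-Lie algebra of smooth vector fields on $N$, and let $\{\cdot,\cdot\}$ be the corresponding Poisson structure on $A$. Then the adjoint $$\sigma^\flat\colon L\longrightarrow D_{\{\cdot,\cdot\}}^{\mathrm{geo}}$$ of $\sigma$ is an isomorphism of $(\mathbb R,A)$-Lie algebras.
   Context: An $(\mathbb R,A)$-Lie algebra is a real Lie algebra $L$ that is an $A$-module and acts on $A$ by derivations, with $(a\alpha)(b)=a\alpha(b)$ and $[\alpha,a\beta]=a[\alpha,\beta]+\alpha(a)\beta$; morphisms are $A$-linear Lie algebra morphisms compatible with the actions on $A$. Vector fields form such an object in the usual way. The symplectic form $\sigma$ is a closed $A$-bilinear alternating form on $L$ whose adjoint $\sigma^\flat$ from $L$ to the $A$-module $D_A^{\mathrm{geo}}$ of smooth $1$-forms on $N$ is an isomorphism of $A$-modules; convention: $\sigma^\flat(X)=\sigma(\cdot,X)$. For $f\in A$ let $X_f=(\sigma^\flat)^{-1}(df)$; the Poisson structure is $\{f,g\}=\sigma(X_f,X_g)$, so that $X_f=\{f,-\}$. $D_{\{\cdot,\cdot\}}^{\mathrm{geo}}$ is $D_A^{\mathrm{geo}}$ with the following $(\mathbb R,A)$-Lie algebra structure: let $\pi_G$ be the alternating $A$-bilinear form on $D_A^{\mathrm{geo}}$ with $\pi_G(df,dg)=\{f,g\}$ and let $\alpha^\sharp$ be the vector field with $\beta(\alpha^\sharp)=\pi_G(\alpha,\beta)$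 for all $1$-forms $\beta$; the bracket is $[\alpha,\beta]=\lambda_{\alpha^\sharp}\beta-\lambda_{\beta^\sharp}\alpha-d(\pi_G(\alpha,\beta))$, where $\lambda$ is the Lie derivative, and the action on $A$ is $\alpha(f)=\alpha^\sharp(f)$. *)

theory Defs
  imports "HOL-Analysis.Analysis" "HOL-Algebra.Module"
begin

section \<open>Lie algebras over a pair consisting of the reals and an algebra\<close>

definition real_ring :: "real ring" where
  "real_ring = \<lparr>carrier = UNIV, monoid.mult = (*), one = 1, ring.zero = 0, add = (+)\<rparr>"

text \<open>The record \<open>module\<close> of HOL-Algebra inherits the fields \<open>mult\<close> and \<open>one\<close> from \<open>ring\<close>.
  The locale \<open>module\<close> says nothing about them for the second structure, and they are not used here.\<close>

record ('c, 'l) RA_Lie = "('c, 'l) module" +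
  lie :: "'l \<Rightarrow> 'l \<Rightarrow> 'l"
  act :: "'l \<Rightarrow> 'c \<Rightarrow> 'c"

text \<open>A real number acts on an \<open>A\<close>-module through the structure map of the real algebra \<open>A\<close>.\<close>

definition real_smult ::
    "(real, 'c, 'x) module_scheme \<Rightarrow> ('c, 'l, 'y) module_scheme \<Rightarrow> real \<Rightarrow> 'l \<Rightarrow> 'l" where
  "real_smult A L r \<alpha> = (r \<odot>\<^bsub>A\<^esub> \<one>\<^bsub>A\<^esub>) \<odot>\<^bsub>L\<^esub> \<alpha>"

definition real_Lie_bracket ::
    "(real, 'c, 'x) module_scheme \<Rightarrow> ('c, 'l, 'y) RA_Lie_scheme \<Rightarrow> bool" where
  "real_Lie_bracket A L \<longleftrightarrow>
     (\<forall>\<alpha>\<in>carrier L. \<forall>\<beta>\<in>carrier L. lie L \<alpha> \<beta> \<in> carrier L) \<and>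
     (\<forall>\<alpha>\<in>carrier L. \<forall>\<beta>\<in>carrier L. \<forall>\<gamma>\<in>carrier L.
        lie L (\<alpha> \<oplus>\<^bsub>L\<^esub> \<beta>) \<gamma> = lie L \<alpha> \<gamma> \<oplus>\<^bsub>L\<^esub> lie L \<beta> \<gamma> \<and>
        lie L \<gamma> (\<alpha> \<oplus>\<^bsub>L\<^esub> \<beta>) = lie L \<gamma> \<alpha> \<oplus>\<^bsub>L\<^esub> lie L \<gamma> \<beta>) \<and>
     (\<forall>r. \<forall>\<alpha>\<in>carrier L. \<forall>\<beta>\<in>carrier L.
        lie L (real_smult A L r \<alpha>) \<beta> = real_smult A L r (lie L \<alpha> \<beta>) \<and>
        lie L \<alpha> (real_smult A L r \<beta>) = real_smult A L r (lie L \<alpha> \<beta>)) \<and>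
     (\<forall>\<alpha>\<in>carrier L. lie L \<alpha> \<alpha> = \<zero>\<^bsub>L\<^esub>) \<and>
     (\<forall>\<alpha>\<in>carrier L. \<forall>\<beta>\<in>carrier L. \<forall>\<gamma>\<in>carrier L.
        lie L \<alpha> (lie L \<beta> \<gamma>) \<oplus>\<^bsub>L\<^esub> lie L \<beta> (lie L \<gamma> \<alpha>) \<oplus>\<^bsub>L\<^esub> lie L \<gamma> (lie L \<alpha> \<beta>) = \<zero>\<^bsub>L\<^esub>)"

definition real_derivation ::
    "(real, 'c, 'x) module_scheme \<Rightarrow> ('c \<Rightarrow> 'c) \<Rightarrow> bool" where
  "real_derivation A D \<longleftrightarrow>
     D \<in> carrier A \<rightarrow> carrier A \<and>
     (\<forall>a\<in>carrier A. \<forall>b\<in>carrier A. D (a \<oplus>\<^bsub>A\<^esub> b) = D a \<oplus>\<^bsub>A\<^esub> D b) \<and>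
     (\<forall>r. \<forall>a\<in>carrier A. D (r \<odot>\<^bsub>A\<^esub> a) = r \<odot>\<^bsub>A\<^esub> D a) \<and>
     (\<forall>a\<in>carrier A. \<forall>b\<in>carrier A. D (a \<otimes>\<^bsub>A\<^esub> b) = D a \<otimes>\<^bsub>A\<^esub> b \<oplus>\<^bsub>A\<^esub> a \<otimes>\<^bsub>A\<^esub> D b)"

locale RA_Lie_algebra =
  fixes A :: "(real, 'c, 'x) module_scheme" and L :: "('c, 'l, 'y) RA_Lie_scheme"
  assumes algebra: "Module.algebra real_ring A"
    and module: "Module.module A L"
    and Lie_bracket: "real_Lie_bracket A L"
    and act_derivation: "\<alpha> \<in> carrier L \<Longrightarrow> real_derivation A (act L \<alpha>)"
    and act_add: "\<lbrakk>\<alpha> \<in> carrier L; \<beta> \<in> carrier L; a \<in> carrier A\<rbrakk>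
      \<Longrightarrow> act L (\<alpha> \<oplus>\<^bsub>L\<^esub> \<beta>) a = act L \<alpha> a \<oplus>\<^bsub>A\<^esub> act L \<beta> a"
    and act_lie: "\<lbrakk>\<alpha> \<in> carrier L; \<beta> \<in> carrier L; a \<in> carrier A\<rbrakk>
      \<Longrightarrow> act L (lie L \<alpha> \<beta>) a = act L \<alpha> (act L \<beta> a) \<ominus>\<^bsub>A\<^esub> act L \<beta> (act L \<alpha> a)"
    and act_smult: "\<lbrakk>a \<in> carrier A; \<alpha> \<in> carrier L; b \<in> carrier A\<rbrakk>
      \<Longrightarrow> act L (a \<odot>\<^bsub>L\<^esub> \<alpha>) b = a \<otimes>\<^bsub>A\<^esub> act L \<alpha> b"
    and lie_smult: "\<lbrakk>\<alpha> \<in> carrier L; a \<in> carrier A; \<beta> \<in> carrier L\<rbrakk>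
      \<Longrightarrow> lie L \<alpha> (a \<odot>\<^bsub>L\<^esub> \<beta>) = a \<odot>\<^bsub>L\<^esub> lie L \<alpha> \<beta> \<oplus>\<^bsub>L\<^esub> act L \<alpha> a \<odot>\<^bsub>L\<^esub> \<beta>"

definition mod_hom ::
    "('c, 'x) ring_scheme \<Rightarrow> ('c, 'm, 'y) module_scheme \<Rightarrow> ('c, 'n, 'z) module_scheme
      \<Rightarrow> ('m \<Rightarrow> 'n) \<Rightarrow> bool" where
  "mod_hom A M M' \<phi> \<longleftrightarrow>
     Module.module A M \<and> Module.module A M' \<and>
     \<phi> \<in> carrier M \<rightarrow> carrier M' \<and>
     (\<forall>x\<in>carrier M. \<forall>y\<in>carrier M. \<phi> (x \<oplus>\<^bsub>M\<^esub> y) = \<phi> x \<oplus>\<^bsub>M'\<^esub> \<phi> y) \<and>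
     (\<forall>a\<in>carrier A. \<forall>x\<in>carrier M. \<phi> (a \<odot>\<^bsub>M\<^esub> x) = a \<odot>\<^bsub>M'\<^esub> \<phi> x)"

definition mod_iso ::
    "('c, 'x) ring_scheme \<Rightarrow> ('c, 'm, 'y) module_scheme \<Rightarrow> ('c, 'n, 'z) module_scheme
      \<Rightarrow> ('m \<Rightarrow> 'n) \<Rightarrow> bool" where
  "mod_iso A M M' \<phi> \<longleftrightarrow> mod_hom A M M' \<phi> \<and> bij_betw \<phi> (carrier M) (carrier M')"

definition RA_Lie_hom ::
    "(real, 'c, 'x) module_scheme \<Rightarrow> ('c, 'l, 'y) RA_Lie_scheme \<Rightarrow> ('c, 'm, 'z) RA_Lie_scheme
      \<Rightarrow> ('l \<Rightarrow> 'm) \<Rightarrow> bool" where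
  "RA_Lie_hom A L L' \<phi> \<longleftrightarrow>
     RA_Lie_algebra A L \<and> RA_Lie_algebra A L' \<and> mod_hom A L L' \<phi> \<and>
     (\<forall>\<alpha>\<in>carrier L. \<forall>\<beta>\<in>carrier L. \<phi> (lie L \<alpha> \<beta>) = lie L' (\<phi> \<alpha>) (\<phi> \<beta>)) \<and>
     (\<forall>\<alpha>\<in>carrier L. \<forall>a\<in>carrier A. act L' (\<phi> \<alpha>) a = act L \<alpha> a)"

definition RA_Lie_iso ::
    "(real, 'c, 'x) module_scheme \<Rightarrow> ('c, 'l, 'y) RA_Lie_scheme \<Rightarrow> ('c, 'm, 'z) RA_Lie_scheme
      \<Rightarrow> ('l \<Rightarrow> 'm) \<Rightarrow> bool" where
  "RA_Lie_iso A L L' \<phi> \<longleftrightarrow> RA_Lie_hom A L L' \<phi> \<and> bij_betw \<phi> (carrier L) (carrier L')"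

definition alternating_form ::
    "('c, 'x) ring_scheme \<Rightarrow> ('c, 'm, 'y) module_scheme \<Rightarrow> ('m \<Rightarrow> 'm \<Rightarrow> 'c) \<Rightarrow> bool" where
  "alternating_form A M b \<longleftrightarrow>
     (\<forall>x\<in>carrier M. \<forall>y\<in>carrier M. b x y \<in> carrier A) \<and>
     (\<forall>x\<in>carrier M. \<forall>y\<in>carrier M. \<forall>z\<in>carrier M.
        b (x \<oplus>\<^bsub>M\<^esub> y) z = b x z \<oplus>\<^bsub>A\<^esub> b y z \<and> b z (x \<oplus>\<^bsub>M\<^esub> y) = b z x \<oplus>\<^bsub>A\<^esub> b z y) \<and>
     (\<forall>a\<in>carrier A. \<forall>x\<in>carrier M. \<forall>y\<in>carrier M.
        b (a \<odot>\<^bsub>M\<^esub> x) y = a \<otimes>\<^bsub>A\<^esub> b x y \<and> b x (a \<odot>\<^bsub>M\<^esub> y) = a \<otimes>\<^bsub>A\<^esub> b x y) \<and>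
     (\<forall>x\<in>carrier M. b x x = \<zero>\<^bsub>A\<^esub>)"


section \<open>Smooth manifolds and smooth functions\<close>

text \<open>The two notions below are used for open sets \<open>S\<close> and finite-dimensional domains only.\<close>

primrec Ck_on ::
    "nat \<Rightarrow> ('e::real_normed_vector \<Rightarrow> 'b::real_normed_vector) \<Rightarrow> 'e set \<Rightarrow> bool" where
  "Ck_on 0 f S \<longleftrightarrow> continuous_on S f"
| "Ck_on (Suc k) f S \<longleftrightarrow>
     (\<forall>x\<in>S. f differentiable at x) \<and> (\<forall>v. Ck_on k (\<lambda>x. frechet_derivative f (at x) v) S)"

definition smooth_on ::
    "('e::real_normed_vector \<Rightarrow> 'b::real_normed_vector) \<Rightarrow> 'e set \<Rightarrow> bool" where
  "smooth_on f S \<longleftrightarrow> (\<forall>k. Ck_on k f S)"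

text \<open>A chart is a pair \<open>(U, \<phi>)\<close>; the values of \<open>\<phi>\<close> outside \<open>U\<close> are irrelevant. The model space is
  an arbitrary finite-dimensional Euclidean vector space. The class \<open>real_inner\<close> together with a
  finite spanning set is used instead of \<open>euclidean_space\<close>, since the latter excludes dimension 0.\<close>

type_synonym ('a, 'e) chart = "'a set \<times> ('a \<Rightarrow> 'e)"

definition is_chart :: "('a::topological_space, 'e::real_inner) chart \<Rightarrow> bool" where
  "is_chart c \<longleftrightarrow> (case c of (U, \<phi>) \<Rightarrow>
     open U \<and> open (\<phi> ` U) \<and> homeomorphism U (\<phi> ` U) \<phi> (inv_into U \<phi>))"

definition smooth_atlas :: "('a::topological_space, 'e::real_inner) chart set \<Rightarrow> bool" where
  "smooth_atlas \<A> \<longleftrightarrow>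
     (\<forall>c\<in>\<A>. is_chart c) \<and> (\<Union>(U, \<phi>)\<in>\<A>. U) = UNIV \<and>
     (\<forall>(U, \<phi>)\<in>\<A>. \<forall>(V, \<psi>)\<in>\<A>. smooth_on (\<psi> \<circ> inv_into U \<phi>) (\<phi> ` (U \<inter> V)))"

definition smooth_manifold ::
    "('a::{t2_space, second_countable_topology}, 'e::real_inner) chart set \<Rightarrow> bool" where
  "smooth_manifold \<A> \<longleftrightarrow> (\<exists>B::'e set. finite B \<and> span B = UNIV) \<and> smooth_atlas \<A>"

definition smooth_functions ::
    "('a::topological_space, 'e::real_inner) chart set \<Rightarrow> ('a \<Rightarrow> real) set" where
  "smooth_functions \<A> = {f. \<forall>(U, \<phi>)\<in>\<A>. smooth_on (f \<circ> inv_into U \<phi>) (\<phi> ` U)}"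

definition smooth_algebra ::
    "('a::topological_space, 'e::real_inner) chart set \<Rightarrow> (real, 'a \<Rightarrow> real) module" where
  "smooth_algebra \<A> = \<lparr>carrier = smooth_functions \<A>,
     monoid.mult = (\<lambda>f g p. f p * g p), one = (\<lambda>p. 1), ring.zero = (\<lambda>p. 0),
     add = (\<lambda>f g p. f p + g p), smult = (\<lambda>r f p. r * f p)\<rparr>"


section \<open>Vector fields and one-forms\<close>

text \<open>A tangent vector at \<open>p\<close> is a derivation at \<open>p\<close> of the algebra of smooth functions. Its value on
  non-smooth functions is set to 0, so that equality of tangent vectors is equality in HOL. The
  same convention is used for covectors, outside the tangent space.\<close>

type_synonym 'a tangent = "('a \<Rightarrow> real) \<Rightarrow> real"
type_synonym 'a vector_field = "'a \<Rightarrow> 'a tangent"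
type_synonym 'a one_form = "'a \<Rightarrow> 'a tangent \<Rightarrow> real"

definition tangent_space ::
    "('a::topological_space, 'e::real_inner) chart set \<Rightarrow> 'a \<Rightarrow> 'a tangent set" where
  "tangent_space \<A> p = {v.
     (\<forall>f\<in>smooth_functions \<A>. \<forall>g\<in>smooth_functions \<A>.
        v (\<lambda>x. f x + g x) = v f + v g \<and> v (\<lambda>x. f x * g x) = v f * g p + f p * v g) \<and>
     (\<forall>r. \<forall>f\<in>smooth_functions \<A>. v (\<lambda>x. r * f x) = r * v f) \<and>
     (\<forall>f. f \<notin> smooth_functions \<A> \<longrightarrow> v f = 0)}"

definition vector_fields ::
    "('a::topological_space, 'e::real_inner) chart set \<Rightarrow> 'a vector_field set" where
  "vector_fields \<A> = {X. (\<forall>p. X p \<in> tangent_space \<A> p) \<and>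
     (\<forall>f\<in>smooth_functions \<A>. (\<lambda>p. X p f) \<in> smooth_functions \<A>)}"

definition vf_bracket :: "'a vector_field \<Rightarrow> 'a vector_field \<Rightarrow> 'a vector_field" where
  "vf_bracket X Y = (\<lambda>p f. X p (\<lambda>q. Y q f) - Y p (\<lambda>q. X q f))"

definition vector_field_algebra ::
    "('a::topological_space, 'e::real_inner) chart set \<Rightarrow> ('a \<Rightarrow> real, 'a vector_field) RA_Lie" where
  "vector_field_algebra \<A> = \<lparr>carrier = vector_fields \<A>, monoid.mult = undefined, one = undefined,
     ring.zero = (\<lambda>p f. 0), add = (\<lambda>X Y p f. X p f + Y p f), smult = (\<lambda>a X p f. a p * X p f),
     lie = vf_bracket, act = (\<lambda>X f p. X p f)\<rparr>"

definition cotangent_space ::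
    "('a::topological_space, 'e::real_inner) chart set \<Rightarrow> 'a \<Rightarrow> ('a tangent \<Rightarrow> real) set" where
  "cotangent_space \<A> p = {\<omega>.
     (\<forall>v\<in>tangent_space \<A> p. \<forall>w\<in>tangent_space \<A> p. \<omega> (\<lambda>f. v f + w f) = \<omega> v + \<omega> w) \<and>
     (\<forall>r. \<forall>v\<in>tangent_space \<A> p. \<omega> (\<lambda>f. r * v f) = r * \<omega> v) \<and>
     (\<forall>v. v \<notin> tangent_space \<A> p \<longrightarrow> \<omega> v = 0)}"

definition pairing :: "'a one_form \<Rightarrow> 'a vector_field \<Rightarrow> 'a \<Rightarrow> real" where
  "pairing \<alpha> X = (\<lambda>p. \<alpha> p (X p))"

definition one_forms ::
    "('a::topological_space, 'e::real_inner) chart set \<Rightarrow> 'a one_form set" where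
  "one_forms \<A> = {\<alpha>. (\<forall>p. \<alpha> p \<in> cotangent_space \<A> p) \<and>
     (\<forall>X\<in>vector_fields \<A>. pairing \<alpha> X \<in> smooth_functions \<A>)}"

definition one_form_module ::
    "('a::topological_space, 'e::real_inner) chart set \<Rightarrow> ('a \<Rightarrow> real, 'a one_form) module" where
  "one_form_module \<A> = \<lparr>carrier = one_forms \<A>, monoid.mult = undefined, one = undefined,
     ring.zero = (\<lambda>p v. 0), add = (\<lambda>\<alpha> \<beta> p v. \<alpha> p v + \<beta> p v), smult = (\<lambda>a \<alpha> p v. a p * \<alpha> p v)\<rparr>"

definition differential ::
    "('a::topological_space, 'e::real_inner) chart set \<Rightarrow> ('a \<Rightarrow> real) \<Rightarrow> 'a one_form" where
  "differential \<A> f = (\<lambda>p v. if v \<in> tangent_space \<A> p then v f else 0)"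

text \<open>The Lie derivative of a one-form, \<open>(\<lambda>\<^sub>X \<beta>)(Z) = X(\<beta>(Z)) - \<beta>([X, Z])\<close>.\<close>

definition Lie_derivative ::
    "('a::topological_space, 'e::real_inner) chart set \<Rightarrow> 'a vector_field \<Rightarrow> 'a one_form \<Rightarrow> 'a one_form"
  where
  "Lie_derivative \<A> X \<beta> = (THE \<gamma>. \<gamma> \<in> one_forms \<A> \<and>
     (\<forall>Z\<in>vector_fields \<A>. \<forall>p. pairing \<gamma> Z p = X p (pairing \<beta> Z) - pairing \<beta> (vf_bracket X Z) p))"


section \<open>Symplectic forms and Poisson structures\<close>

text \<open>A two-form is an alternating form, bilinear over the smooth functions, on the vector fields.\<close>

type_synonym 'a two_form = "'a vector_field \<Rightarrow> 'a vector_field \<Rightarrow> 'a \<Rightarrow> real"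

definition closed_two_form ::
    "('a::topological_space, 'e::real_inner) chart set \<Rightarrow> 'a two_form \<Rightarrow> bool" where
  "closed_two_form \<A> \<sigma> \<longleftrightarrow>
     (\<forall>X\<in>vector_fields \<A>. \<forall>Y\<in>vector_fields \<A>. \<forall>Z\<in>vector_fields \<A>. \<forall>p.
        X p (\<sigma> Y Z) - Y p (\<sigma> X Z) + Z p (\<sigma> X Y)
        - \<sigma> (vf_bracket X Y) Z p + \<sigma> (vf_bracket X Z) Y p - \<sigma> (vf_bracket Y Z) X p = 0)"

text \<open>The adjoint sends \<open>X\<close> to \<open>\<sigma>(\<cdot>, X)\<close>, read as a pointwise one-form.\<close>

definition flat ::
    "('a::topological_space, 'e::real_inner) chart set \<Rightarrow> 'a two_form \<Rightarrow> 'a vector_field \<Rightarrow> 'a one_form"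
  where
  "flat \<A> \<sigma> X = (THE \<alpha>. \<alpha> \<in> one_forms \<A> \<and> (\<forall>Y\<in>vector_fields \<A>. pairing \<alpha> Y = \<sigma> Y X))"

definition symplectic_form ::
    "('a::topological_space, 'e::real_inner) chart set \<Rightarrow> 'a two_form \<Rightarrow> bool" where
  "symplectic_form \<A> \<sigma> \<longleftrightarrow>
     alternating_form (smooth_algebra \<A>) (vector_field_algebra \<A>) \<sigma> \<and>
     closed_two_form \<A> \<sigma> \<and>
     mod_iso (smooth_algebra \<A>) (vector_field_algebra \<A>) (one_form_module \<A>) (flat \<A> \<sigma>)"

definition hamiltonian_field ::
    "('a::topological_space, 'e::real_inner) chart set \<Rightarrow> 'a two_form \<Rightarrow> ('a \<Rightarrow> real) \<Rightarrow> 'a vector_field"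
  where
  "hamiltonian_field \<A> \<sigma> f = inv_into (vector_fields \<A>) (flat \<A> \<sigma>) (differential \<A> f)"

definition poisson_bracket ::
    "('a::topological_space, 'e::real_inner) chart set \<Rightarrow> 'a two_form
      \<Rightarrow> ('a \<Rightarrow> real) \<Rightarrow> ('a \<Rightarrow> real) \<Rightarrow> 'a \<Rightarrow> real" where
  "poisson_bracket \<A> \<sigma> f g = \<sigma> (hamiltonian_field \<A> \<sigma> f) (hamiltonian_field \<A> \<sigma> g)"

text \<open>The form \<open>\<pi>\<^sub>G\<close> of a Poisson structure \<open>P\<close>. The defining property determines it on smooth
  one-forms; the choice operator only fixes the irrelevant values elsewhere.\<close>

definition poisson_tensor ::
    "('a::topological_space, 'e::real_inner) chart set
      \<Rightarrow> (('a \<Rightarrow> real) \<Rightarrow> ('a \<Rightarrow> real) \<Rightarrow> 'a \<Rightarrow> real) \<Rightarrow> 'a one_form \<Rightarrow> 'a one_form \<Rightarrow> 'a \<Rightarrow> real" where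
  "poisson_tensor \<A> P = (SOME \<pi>.
     alternating_form (smooth_algebra \<A>) (one_form_module \<A>) \<pi> \<and>
     (\<forall>f\<in>smooth_functions \<A>. \<forall>g\<in>smooth_functions \<A>.
        \<pi> (differential \<A> f) (differential \<A> g) = P f g))"

definition sharp ::
    "('a::topological_space, 'e::real_inner) chart set
      \<Rightarrow> (('a \<Rightarrow> real) \<Rightarrow> ('a \<Rightarrow> real) \<Rightarrow> 'a \<Rightarrow> real) \<Rightarrow> 'a one_form \<Rightarrow> 'a vector_field" where
  "sharp \<A> P \<alpha> = (THE X. X \<in> vector_fields \<A> \<and>
     (\<forall>\<beta>\<in>one_forms \<A>. pairing \<beta> X = poisson_tensor \<A> P \<alpha> \<beta>))"

definition one_form_bracket ::
    "('a::topological_space, 'e::real_inner) chart set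
      \<Rightarrow> (('a \<Rightarrow> real) \<Rightarrow> ('a \<Rightarrow> real) \<Rightarrow> 'a \<Rightarrow> real) \<Rightarrow> 'a one_form \<Rightarrow> 'a one_form \<Rightarrow> 'a one_form" where
  "one_form_bracket \<A> P \<alpha> \<beta> = (\<lambda>p v.
     Lie_derivative \<A> (sharp \<A> P \<alpha>) \<beta> p v - Lie_derivative \<A> (sharp \<A> P \<beta>) \<alpha> p v
     - differential \<A> (poisson_tensor \<A> P \<alpha> \<beta>) p v)"

definition poisson_one_form_algebra ::
    "('a::topological_space, 'e::real_inner) chart set
      \<Rightarrow> (('a \<Rightarrow> real) \<Rightarrow> ('a \<Rightarrow> real) \<Rightarrow> 'a \<Rightarrow> real) \<Rightarrow> ('a \<Rightarrow> real, 'a one_form) RA_Lie" where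
  "poisson_one_form_algebra \<A> P = \<lparr>carrier = carrier (one_form_module \<A>),
     monoid.mult = undefined, one = undefined,
     ring.zero = ring.zero (one_form_module \<A>), add = add (one_form_module \<A>),
     smult = smult (one_form_module \<A>),
     lie = one_form_bracket \<A> P, act = (\<lambda>\<alpha> f p. sharp \<A> P \<alpha> p f)\<rparr>"

end

theory Submission
  imports Defs
begin

text \<open>Write \<open>\<flat>\<close> for the adjoint of \<open>\<sigma>\<close>. Nondegeneracy says that \<open>\<flat>\<close> is an isomorphism of modules, and the form
\<open>(\<alpha>, \<beta>) \<mapsto> \<sigma>(\<flat>\<^sup>-\<^sup>1 \<alpha>, \<flat>\<^sup>-\<^sup>1 \<beta>)\<close> takes the value \<open>\<sigma>(X\<^sub>f, X\<^sub>g) = {f, g}\<close> on a pair of differentials, so it is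
\<open>\<pi>\<^sub>G\<close>. The equation \<open>\<beta>(\<flat>\<^sup>-\<^sup>1 \<alpha>) = \<sigma>(\<flat>\<^sup>-\<^sup>1 \<alpha>, \<flat>\<^sup>-\<^sup>1 \<beta>) = \<pi>\<^sub>G(\<alpha>, \<beta>)\<close> then identifies the vector field attached
to a one-form \<open>\<alpha>\<close> as \<open>\<flat>\<^sup>-\<^sup>1 \<alpha>\<close>, which is the compatibility of \<open>\<flat>\<close> with the actions on functions
(\<open>poisson_tensor\<close>, \<open>sharp\<close>). For the brackets, evaluate \<open>[\<flat>X, \<flat>Y]\<close> on a vector field \<open>Z\<close> and write out the
two Lie derivatives: the difference from \<open>\<flat>[X, Y](Z) = \<sigma>(Z, [X, Y])\<close> is, up to sign, \<open>d\<sigma>(X, Y, Z)\<close>, and it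
vanishes because \<open>\<sigma>\<close> is closed (\<open>flat_bracket\<close>). Vector fields form an \<open>(R, A)\<close>-Lie algebra, hence so do
one-forms, by transport of structure along \<open>\<flat>\<close> (\<open>RA_Lie_algebra_transfer\<close>).

This argument silently uses three facts about a manifold: a one-form is determined by its values on
global vector fields; every function-linear functional on vector fields is a pointwise one-form (so that
\<open>\<flat>X\<close> and the Lie derivatives exist); and a function-linear functional on one-forms is
determined by its values on differentials (so that \<open>\<pi>\<^sub>G\<close> is unique). All three follow from a single
statement, \<open>local_frame\<close>: near any point \<open>p\<close> there are global functions \<open>\<rho>\<close>, \<open>f\<^sub>i\<close> and global
vector fields \<open>e\<^sub>i\<close>, finitely many, with \<open>\<rho>(p) = 1\<close> and \<open>\<rho>(q) v = \<Sum>\<^sub>i v(f\<^sub>i) e\<^sub>i(q)\<close> for every tangent vector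
\<open>v\<close> at every point \<open>q\<close>. Tangent vectors being derivations of the algebra of global functions, this rests on
Hadamard's lemma in a chart, together with bump functions that extend local data to the manifold.\<close>

section \<open>Functions of class $C^k$ on open sets\<close>

lemma Ck_on_cong:
  assumes "open S" "\<And>x. x \<in> S \<Longrightarrow> f x = g x" "Ck_on k f S"
  shows "Ck_on k g S"
  using assms(2,3)
proof (induction k arbitrary: f g)
  case 0
  then show ?case by (simp cong: continuous_on_cong)
next
  case (Suc k)
  have D: "(g has_derivative frechet_derivative f (at x)) (at x)" if "x \<in> S" for x
  proof (rule has_derivative_transform_within_open[OF _ assms(1) that])
    show "(f has_derivative frechet_derivative f (at x)) (at x)"
      using Suc.prems(2) that by (auto simp: frechet_derivative_works)
  qed (use Suc.prems in auto)
  have "Ck_on k (\<lambda>x. frechet_derivative g (at x) v) S" for v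
  proof (rule Suc.IH)
    show "frechet_derivative f (at x) v = frechet_derivative g (at x) v" if "x \<in> S" for x
      using frechet_derivative_at[OF D[OF that]] by simp
    show "Ck_on k (\<lambda>x. frechet_derivative f (at x) v) S"
      using Suc.prems(2) by simp
  qed
  then show ?case using D by (auto simp: differentiable_def)
qed

text \<open>Any family of derivatives serves to climb one degree, since on an open set it agrees with
\<^const>\<open>frechet_derivative\<close>.\<close>

lemma Ck_on_SucI:
  assumes "open S" "\<And>x. x \<in> S \<Longrightarrow> (f has_derivative D x) (at x)"
    "\<And>v. Ck_on k (\<lambda>x. D x v) S"
  shows "Ck_on (Suc k) f S"
proof -
  have D: "D x = frechet_derivative f (at x)" if "x \<in> S" for x
    using assms(2)[OF that] by (rule frechet_derivative_at)
  have "Ck_on k (\<lambda>x. frechet_derivative f (at x) v) S" for v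
    by (rule Ck_on_cong[OF assms(1) _ assms(3)[of v]]) (simp add: D)
  then show ?thesis using assms(2) by (auto simp: differentiable_def)
qed

lemma Ck_on_has_derivative:
  "Ck_on (Suc k) f S \<Longrightarrow> x \<in> S \<Longrightarrow> (f has_derivative frechet_derivative f (at x)) (at x)"
  by (auto simp: frechet_derivative_works)

lemma Ck_on_Suc_imp: "Ck_on (Suc k) f S \<Longrightarrow> Ck_on k f S"
proof (induction k arbitrary: f)
  case 0
  then show ?case
    by (auto intro!: continuous_at_imp_continuous_on differentiable_imp_continuous_within)
qed auto

lemma Ck_on_antimono: "j \<le> k \<Longrightarrow> Ck_on k f S \<Longrightarrow> Ck_on j f S"
proof (induction k)
  case (Suc k)
  then show ?case by (cases "j = Suc k") (auto dest: Ck_on_Suc_imp simp del: Ck_on.simps)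
qed simp

lemma Ck_on_subset: "Ck_on k f S \<Longrightarrow> T \<subseteq> S \<Longrightarrow> Ck_on k f T"
proof (induction k arbitrary: f)
  case 0
  then show ?case using continuous_on_subset by auto
next
  case (Suc k)
  then show ?case by (simp add: subset_iff)
qed

lemma Ck_on_local:
  assumes "\<And>x. x \<in> S \<Longrightarrow> \<exists>T. open T \<and> x \<in> T \<and> Ck_on k f T"
  shows "Ck_on k f S"
  using assms
proof (induction k arbitrary: f)
  case 0
  have "continuous (at x) f" if "x \<in> S" for x
    using 0[OF that] by (auto simp: continuous_on_eq_continuous_at)
  then show ?case
    by (auto simp: continuous_on_eq_continuous_within continuous_at_imp_continuous_at_within)
next
  case (Suc k)
  have "f differentiable at x" if "x \<in> S" for x
    using Suc.prems[OF that] by auto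
  moreover have "Ck_on k (\<lambda>x. frechet_derivative f (at x) v) S" for v
    using Suc.prems by (intro Suc.IH) fastforce
  ultimately show ?case by simp
qed

lemma Ck_on_const: "open S \<Longrightarrow> Ck_on k (\<lambda>x. c) S"
proof (induction k arbitrary: c)
  case (Suc k)
  show ?case by (rule Ck_on_SucI[where D = "\<lambda>x v. 0"]) (use Suc in auto)
qed simp

lemma Ck_on_bounded_linear: "open S \<Longrightarrow> bounded_linear g \<Longrightarrow> Ck_on k f S \<Longrightarrow> Ck_on k (\<lambda>x. g (f x)) S"
proof (induction k arbitrary: f)
  case 0
  then show ?case by (auto intro: bounded_linear.continuous_on)
next
  case (Suc k)
  show ?case
  proof (rule Ck_on_SucI[where D = "\<lambda>x v. g (frechet_derivative f (at x) v)"])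
    show "((\<lambda>x. g (f x)) has_derivative (\<lambda>v. g (frechet_derivative f (at x) v))) (at x)" if "x \<in> S" for x
      by (rule bounded_linear.has_derivative[OF Suc.prems(2) Ck_on_has_derivative[OF Suc.prems(3) that]])
    show "Ck_on k (\<lambda>x. g (frechet_derivative f (at x) v)) S" for v
      using Suc by auto
  qed (rule Suc.prems)
qed

lemma Ck_on_linear: "open S \<Longrightarrow> bounded_linear g \<Longrightarrow> Ck_on k g S"
proof (cases k)
  case (Suc n)
  assume "open S" "bounded_linear g"
  then show ?thesis unfolding Suc
    by (intro Ck_on_SucI[where D = "\<lambda>x. g"] bounded_linear_imp_has_derivative Ck_on_const)
qed (auto intro: linear_continuous_on)

lemma Ck_on_add: "open S \<Longrightarrow> Ck_on k f S \<Longrightarrow> Ck_on k g S \<Longrightarrow> Ck_on k (\<lambda>x. f x + g x) S"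
proof (induction k arbitrary: f g)
  case 0
  then show ?case by (auto intro: continuous_on_add)
next
  case (Suc k)
  show ?case
    by (rule Ck_on_SucI[OF Suc.prems(1) has_derivative_add[OF Ck_on_has_derivative[OF Suc.prems(2)]
            Ck_on_has_derivative[OF Suc.prems(3)]]])
      (use Suc in auto)
qed

lemma Ck_on_mult:
  fixes f g :: "_ \<Rightarrow> real"
  shows "open S \<Longrightarrow> Ck_on k f S \<Longrightarrow> Ck_on k g S \<Longrightarrow> Ck_on k (\<lambda>x. f x * g x) S"
proof (induction k arbitrary: f g)
  case 0
  then show ?case by (auto intro: continuous_on_mult)
next
  case (Suc k)
  show ?case
  proof (rule Ck_on_SucI[OF Suc.prems(1) has_derivative_mult[OF Ck_on_has_derivative[OF Suc.prems(2)]
          Ck_on_has_derivative[OF Suc.prems(3)]]])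
    fix v
    have "Ck_on k f S" "Ck_on k g S" "Ck_on k (\<lambda>x. frechet_derivative f (at x) v) S"
      "Ck_on k (\<lambda>x. frechet_derivative g (at x) v) S"
      using Suc.prems(2,3) by (auto intro: Ck_on_Suc_imp)
    then show "Ck_on k (\<lambda>x. f x * frechet_derivative g (at x) v + frechet_derivative f (at x) v * g x) S"
      by (intro Ck_on_add Suc.IH Suc.prems(1))
  qed
qed

lemma Ck_on_sum:
  assumes "open S" "\<And>i. i \<in> I \<Longrightarrow> Ck_on k (f i) S"
  shows "Ck_on k (\<lambda>x. \<Sum>i\<in>I. f i x) S"
  using assms(2)
proof (induction I rule: infinite_finite_induct)
  case (insert i I)
  then show ?case using Ck_on_add[OF assms(1), of k "f i"] by simp
qed (simp_all add: Ck_on_const assms(1))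

section \<open>Coordinates in the model space\<close>

text \<open>The expansion that an orthonormal basis provides. Its coordinates are inner products, hence
bounded linear functionals.\<close>

definition parseval_frame :: "'e::real_inner set \<Rightarrow> bool" where
  "parseval_frame B \<longleftrightarrow> finite B \<and> (\<forall>x. x = (\<Sum>b\<in>B. (x \<bullet> b) *\<^sub>R b))"

text \<open>Gram--Schmidt, followed by normalising the nonzero vectors.\<close>

lemma parseval_frame_exists:
  assumes "finite B" "span B = (UNIV :: 'e::real_inner set)"
  shows "\<exists>C :: 'e set. parseval_frame C"
proof -
  obtain C :: "'e set" where C: "finite C" "span C = UNIV" "pairwise orthogonal C"
    using basis_orthogonal[OF assms(1)] assms(2) by auto
  define N where "N = (\<lambda>x :: 'e. x /\<^sub>R norm x)"
  have *: "(\<Sum>c\<in>C. (x \<bullet> c / (c \<bullet> c)) *\<^sub>R c) = x" for x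
  proof -
    have "x \<in> span C" using C by simp
    then show ?thesis
    proof (induction rule: span_induct_alt)
      case base
      then show ?case by simp
    next
      case (step r y x)
      have "(\<Sum>c\<in>C. (y \<bullet> c / (c \<bullet> c)) *\<^sub>R c) = (\<Sum>c\<in>C. if c = y then y else 0)"
        using C(3) step(1) by (intro sum.cong) (auto simp: pairwise_def orthogonal_def)
      also have "\<dots> = y" using C(1) step(1) by simp
      finally have y: "(\<Sum>c\<in>C. (y \<bullet> c / (c \<bullet> c)) *\<^sub>R c) = y" .
      have "(\<Sum>c\<in>C. ((r *\<^sub>R y + x) \<bullet> c / (c \<bullet> c)) *\<^sub>R c)
          = r *\<^sub>R (\<Sum>c\<in>C. (y \<bullet> c / (c \<bullet> c)) *\<^sub>R c) + (\<Sum>c\<in>C. (x \<bullet> c / (c \<bullet> c)) *\<^sub>R c)"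
        by (simp add: inner_add_left add_divide_distrib scaleR_add_left sum.distrib scaleR_sum_right)
      then show ?case using y step by simp
    qed
  qed
  \<comment> \<open>Two distinct orthogonal nonzero vectors cannot have the same direction.\<close>
  have inj: "inj_on N (C - {0})"
  proof (rule inj_onI, rule ccontr)
    fix x y assume xy: "x \<in> C - {0}" "y \<in> C - {0}" "N x = N y" "x \<noteq> y"
    then have "x \<bullet> y = 0" using C(3) by (auto simp: pairwise_def orthogonal_def)
    then have "N x \<bullet> N y = 0" by (simp add: N_def)
    then have "N x = 0" using xy(3) by simp
    then show False using xy(1) by (simp add: N_def)
  qed
  have "(\<Sum>b\<in>N ` (C - {0}). (x \<bullet> b) *\<^sub>R b) = x" for x
  proof -
    have "(\<Sum>b\<in>N ` (C - {0}). (x \<bullet> b) *\<^sub>R b) = (\<Sum>c\<in>C - {0}. (x \<bullet> N c) *\<^sub>R N c)"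
      by (simp add: sum.reindex[OF inj])
    also have "\<dots> = (\<Sum>c\<in>C - {0}. (x \<bullet> c / (c \<bullet> c)) *\<^sub>R c)"
      by (intro sum.cong) (auto simp: N_def dot_square_norm power2_eq_square field_simps)
    also have "\<dots> = (\<Sum>c\<in>C. (x \<bullet> c / (c \<bullet> c)) *\<^sub>R c)"
      by (rule sum.mono_neutral_left) (use C in auto)
    finally show ?thesis using * by simp
  qed
  then show ?thesis unfolding parseval_frame_def
    using C(1) by (intro exI[of _ "N ` (C - {0})"]) auto
qed

lemma parseval_frame_expand_linear:
  assumes "parseval_frame B" "linear f"
  shows "f x = (\<Sum>b\<in>B. (x \<bullet> b) *\<^sub>R f b)"
proof -
  have "f x = f (\<Sum>b\<in>B. (x \<bullet> b) *\<^sub>R b)"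
    using assms(1) by (metis parseval_frame_def)
  then show ?thesis by (simp add: linear_sum[OF assms(2)] linear_cmul[OF assms(2)])
qed

text \<open>The derivative of \<open>f \<circ> g\<close> in direction \<open>v\<close> is \<open>\<Sum>\<^sub>b (g'(x) v \<bullet> b) f'(g x) b\<close>: expanding in the frame
separates the two occurrences of \<open>x\<close>, so that the product rule and the induction hypothesis apply.\<close>

lemma Ck_on_comp:
  fixes f :: "'e::real_inner \<Rightarrow> real" and g :: "'d::real_normed_vector \<Rightarrow> 'e" and B :: "'e set"
  assumes B: "parseval_frame B" and S: "open S" and T: "g ` S \<subseteq> T"
  shows "Ck_on k g S \<Longrightarrow> Ck_on k f T \<Longrightarrow> Ck_on k (\<lambda>x. f (g x)) S"
proof (induction k arbitrary: f)
  case 0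
  then show ?case using T by (auto intro: continuous_on_compose2)
next
  case (Suc k)
  let ?g = "\<lambda>x. frechet_derivative g (at x)" and ?f = "\<lambda>y. frechet_derivative f (at y)"
  have lin: "linear (?f (g x))" if "x \<in> S" for x
    using has_derivative_linear[OF Ck_on_has_derivative[OF Suc.prems(2)]] T that by auto
  show ?case
  proof (rule Ck_on_SucI[OF S, where D = "\<lambda>x v. ?f (g x) (?g x v)"])
    show "((\<lambda>x. f (g x)) has_derivative (\<lambda>v. ?f (g x) (?g x v))) (at x)" if "x \<in> S" for x
      using has_derivative_compose[OF Ck_on_has_derivative[OF Suc.prems(1) that]
            Ck_on_has_derivative[OF Suc.prems(2), of "g x"]] T that by auto
    fix v
    have "Ck_on k (\<lambda>x. ?g x v \<bullet> b) S" for b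
      using Suc.prems(1) by (intro Ck_on_bounded_linear[OF S bounded_linear_inner_left]) auto
    moreover have "Ck_on k (\<lambda>x. ?f (g x) b) S" for b
      using Suc.prems(2) by (intro Suc.IH Ck_on_Suc_imp[OF Suc.prems(1)]) auto
    ultimately have "Ck_on k (\<lambda>x. \<Sum>b\<in>B. (?g x v \<bullet> b) * ?f (g x) b) S"
      by (intro Ck_on_sum[OF S] Ck_on_mult[OF S])
    then show "Ck_on k (\<lambda>x. ?f (g x) (?g x v)) S"
    proof (rule Ck_on_cong[OF S, rotated])
      show "(\<Sum>b\<in>B. (?g x v \<bullet> b) * ?f (g x) b) = ?f (g x) (?g x v)" if "x \<in> S" for x
        unfolding parseval_frame_expand_linear[OF B lin[OF that], of "?g x v"] by simp
    qed
  qed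
qed

section \<open>Bump functions\<close>

lemma poly_div_exp_tendsto_0: "((\<lambda>x::real. poly P x / exp x) \<longlongrightarrow> 0) at_top"
proof -
  have "((\<lambda>x. \<Sum>i\<le>degree P. coeff P i * (x ^ i / exp x)) \<longlongrightarrow> (\<Sum>i\<le>degree P. coeff P i * 0)) at_top"
    by (intro tendsto_sum tendsto_mult tendsto_const tendsto_power_div_exp_0)
  then show ?thesis by (simp add: poly_altdef sum_divide_distrib)
qed

text \<open>The functions \<open>p(1/t) exp(-1/t)\<close>, extended by zero to \<open>t \<le> 0\<close>. With arbitrary
polynomials \<open>p\<close> the family is closed under differentiation, which makes all of its members smooth.\<close>

definition flat_exp :: "real poly \<Rightarrow> real \<Rightarrow> real" where
  "flat_exp P t = (if t > 0 then poly P (1 / t) * exp (- 1 / t) else 0)"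

lemma flat_exp_has_derivative:
  "(flat_exp P has_real_derivative flat_exp ([:0, 0, 1:] * (P - pderiv P)) t) (at t)"
proof -
  consider "t < 0" | "t > 0" | "t = 0" by linarith
  then show ?thesis
  proof cases
    assume "t < 0"
    have "((\<lambda>_. 0) has_real_derivative 0) (at t)" by simp
    then show ?thesis
      by (rule has_field_derivative_transform_within_open[of _ _ _ "{..<0}", THEN DERIV_cong])
        (use \<open>t < 0\<close> in \<open>auto simp: flat_exp_def\<close>)
  next
    assume "t > 0"
    have "((\<lambda>t. poly P (1 / t) * exp (- 1 / t)) has_real_derivative
        poly (pderiv P) (1 / t) * (- 1 / t ^ 2) * exp (- 1 / t) + poly P (1 / t) * (exp (- 1 / t) * (1 / t ^ 2))) (at t)"
      using \<open>t > 0\<close>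
      by (auto intro!: derivative_eq_intros poly_DERIV[THEN DERIV_chain2] simp: power2_eq_square field_simps)
    then show ?thesis
      by (rule has_field_derivative_transform_within_open[of _ _ _ "{0<..}", THEN DERIV_cong])
        (use \<open>t > 0\<close> in \<open>auto simp: flat_exp_def power2_eq_square field_simps\<close>)
  next
    assume t: "t = 0"
    have "((\<lambda>h. flat_exp P h / h) \<longlongrightarrow> 0) (at_right 0)"
    proof (rule Lim_transform_eventually)
      show "((\<lambda>h::real. poly ([:0, 1:] * P) (inverse h) / exp (inverse h)) \<longlongrightarrow> 0) (at_right 0)"
        by (rule filterlim_compose[OF poly_div_exp_tendsto_0 filterlim_inverse_at_top_right])
      show "\<forall>\<^sub>F h in at_right 0. poly ([:0, 1:] * P) (inverse h) / exp (inverse h) = flat_exp P h / h"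
        by (rule eventually_at_right_less[THEN eventually_mono])
          (auto simp: flat_exp_def exp_minus field_simps)
    qed
    moreover have "((\<lambda>h. flat_exp P h / h) \<longlongrightarrow> 0) (at_left 0)"
      by (rule tendsto_eventually) (auto simp: flat_exp_def eventually_at_filter)
    ultimately have "((\<lambda>h. flat_exp P h / h) \<longlongrightarrow> 0) (at 0)"
      by (simp add: filterlim_at_split)
    then show ?thesis by (simp add: DERIV_def t flat_exp_def)
  qed
qed

lemma Ck_on_flat_exp: "open S \<Longrightarrow> Ck_on k (flat_exp P) S"
proof (induction k arbitrary: P)
  case 0
  show ?case
    using DERIV_isCont[OF flat_exp_has_derivative] by (simp add: continuous_at_imp_continuous_on)
next
  case (Suc k)
  show ?case
  proof (rule Ck_on_SucI[OF Suc.prems])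
    show "(flat_exp P has_derivative (*) (flat_exp ([:0, 0, 1:] * (P - pderiv P)) t)) (at t)" for t
      using flat_exp_has_derivative unfolding has_field_derivative_def .
    show "Ck_on k (\<lambda>t. flat_exp ([:0, 0, 1:] * (P - pderiv P)) t * v) S" for v
      by (intro Ck_on_mult Ck_on_const Suc)
  qed
qed

lemma parseval_frame_real: "parseval_frame {1 :: real}"
  by (simp add: parseval_frame_def)

text \<open>For \<open>r > 0\<close>, smooth and nonzero exactly on the open ball of radius \<open>r\<close> around \<open>c\<close>.\<close>

definition bump :: "'e::real_inner \<Rightarrow> real \<Rightarrow> 'e \<Rightarrow> real" where
  "bump c r x = flat_exp 1 (r\<^sup>2 - (x - c) \<bullet> (x - c))"

lemma bump_nonzero_iff: "r > 0 \<Longrightarrow> bump c r x \<noteq> 0 \<longleftrightarrow> dist c x < r"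
proof -
  assume "r > 0"
  then have "r\<^sup>2 \<le> (dist c x)\<^sup>2 \<longleftrightarrow> r \<le> dist c x"
    using abs_le_square_iff[of r "dist c x"] by simp
  moreover have "(x - c) \<bullet> (x - c) = (dist c x)\<^sup>2"
    by (metis dist_commute dist_norm power2_norm_eq_inner)
  ultimately show ?thesis by (auto simp: bump_def flat_exp_def)
qed

lemma Ck_on_bump:
  assumes S: "open S" shows "Ck_on k (bump c r) S"
proof -
  have lin: "Ck_on k (\<lambda>x. (x - c) \<bullet> v) S" for k v
  proof -
    have "Ck_on k (\<lambda>x. x \<bullet> v + - (c \<bullet> v)) S"
      by (intro Ck_on_add Ck_on_const Ck_on_linear bounded_linear_inner_left S)
    then show ?thesis by (simp add: inner_diff_left)
  qed
  have "Ck_on k (\<lambda>x. r\<^sup>2 - (x - c) \<bullet> (x - c)) S"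
  proof (cases k)
    case 0
    then show ?thesis by (auto intro!: continuous_intros)
  next
    case (Suc n)
    show ?thesis unfolding Suc
    proof (rule Ck_on_SucI[OF S])
      show "((\<lambda>x. r\<^sup>2 - (x - c) \<bullet> (x - c)) has_derivative (\<lambda>v. -2 * ((x - c) \<bullet> v))) (at x)" for x
        by (auto intro!: derivative_eq_intros simp: inner_commute)
      show "Ck_on n (\<lambda>x. -2 * ((x - c) \<bullet> v)) S" for v
        by (intro Ck_on_mult Ck_on_const S lin)
    qed
  qed
  then show ?thesis unfolding bump_def[abs_def]
    by (rule Ck_on_comp[OF parseval_frame_real S subset_UNIV]) (simp add: Ck_on_flat_exp)
qed

section \<open>Hadamard's lemma\<close>

text \<open>Controls a linear map by finitely many of its values. For a difference of two derivatives it
gives an operator norm estimate from the continuity of the directional derivatives.\<close>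

lemma parseval_frame_linear_bound:
  fixes f :: "'e::real_inner \<Rightarrow> real" and B :: "'e set"
  assumes B: "parseval_frame B" and f: "linear f"
  shows "\<bar>f x\<bar> \<le> norm x * (\<Sum>b\<in>B. norm b * \<bar>f b\<bar>)"
proof -
  have "\<bar>f x\<bar> \<le> (\<Sum>b\<in>B. \<bar>(x \<bullet> b) * f b\<bar>)"
    by (subst parseval_frame_expand_linear[OF B f, of x]) (simp add: sum_abs)
  also have "\<dots> \<le> (\<Sum>b\<in>B. norm x * (norm b * \<bar>f b\<bar>))"
    by (intro sum_mono)
      (simp add: abs_mult Cauchy_Schwarz_ineq2 mult_right_mono flip: mult.assoc)
  finally show ?thesis by (simp add: sum_distrib_left)
qed

lemma parseval_frame_bounded_linear:
  fixes f :: "'e::real_inner \<Rightarrow> real" and B :: "'e set"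
  assumes "parseval_frame B" and "linear f"
  shows "bounded_linear f"
proof (rule bounded_linear_intro)
  show "norm (f x) \<le> norm x * (\<Sum>b\<in>B. norm b * \<bar>f b\<bar>)" for x
    using parseval_frame_linear_bound[OF assms, of x] by simp
qed (simp_all add: linear_add[OF assms(2)] linear_cmul[OF assms(2)])

text \<open>A weighted mean of \<open>h\<close> over the segment from \<open>c\<close> to \<open>x\<close>. Differentiating in \<open>x\<close> replaces \<open>h\<close> by its
derivative and \<open>m\<close> by \<open>m + 1\<close>, so the family over all \<open>m\<close> admits an induction on the degree of smoothness.\<close>

definition segment_moment :: "'e::real_normed_vector \<Rightarrow> nat \<Rightarrow> ('e \<Rightarrow> real) \<Rightarrow> 'e \<Rightarrow> real" where
  "segment_moment c m h x = integral {0..1} (\<lambda>t. t ^ m * h (c + t *\<^sub>R (x - c)))"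

lemma convex_segment_point:
  assumes "convex S" "c \<in> S" "x \<in> S" "0 \<le> t" "t \<le> 1"
  shows "c + t *\<^sub>R (x - c) \<in> S"
proof -
  have "c + t *\<^sub>R (x - c) = (1 - t) *\<^sub>R c + t *\<^sub>R x" by (simp add: algebra_simps)
  then show ?thesis using assms by (simp add: convexD_alt)
qed

lemma continuous_on_segment_integrand:
  fixes h :: "'e::real_normed_vector \<Rightarrow> real"
  assumes S: "convex S" "c \<in> S" and h: "continuous_on S h"
  shows "continuous_on (S \<times> {0..1}) (\<lambda>(x, t). t ^ m * h (c + t *\<^sub>R (x - c)))"
proof -
  have "continuous_on (S \<times> {0..1}) (\<lambda>y. h (c + snd y *\<^sub>R (fst y - c)))"
    by (rule continuous_on_compose2[OF h])
      (auto intro!: continuous_intros convex_segment_point[OF S])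
  then show ?thesis unfolding split_beta by (intro continuous_intros)
qed

lemma segment_integrand_integrable:
  fixes h :: "'e::real_normed_vector \<Rightarrow> real"
  assumes S: "convex S" "c \<in> S" and h: "continuous_on S h" and x: "x \<in> S"
  shows "(\<lambda>t. t ^ m * h (c + t *\<^sub>R (x - c))) integrable_on {0..1}"
proof -
  have "continuous_on {0..1} (\<lambda>t. h (c + t *\<^sub>R (x - c)))"
    by (rule continuous_on_compose2[OF h])
      (auto intro!: continuous_intros convex_segment_point[OF S x])
  then show ?thesis by (intro integrable_continuous_real continuous_intros)
qed

text \<open>Differentiation under the integral sign. By compactness of the unit interval the derivative of
the integrand varies little, uniformly in \<open>t\<close>, near \<open>x\<close>; the mean value inequality turns this
into a bound on the linearisation error that can be integrated.\<close>

lemma segment_moment_has_derivative: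
  fixes h :: "'e::real_inner \<Rightarrow> real" and B :: "'e set"
  assumes B: "parseval_frame B" and S: "open S" "convex S" "c \<in> S"
    and h: "Ck_on (Suc 0) h S" and x: "x \<in> S"
  shows "(segment_moment c m h has_derivative
      (\<lambda>v. segment_moment c (Suc m) (\<lambda>z. frechet_derivative h (at z) v) x)) (at x)"
proof -
  let ?z = "\<lambda>y t. c + t *\<^sub>R (y - c)"
  let ?D = "\<lambda>y. frechet_derivative h (at y)"
  have D: "(h has_derivative ?D y) (at y)" if "y \<in> S" for y
    using Ck_on_has_derivative[OF h that] .
  have lin: "linear (?D y)" if "y \<in> S" for y
    using D[OF that] by (rule has_derivative_linear)
  have cont: "continuous_on S (\<lambda>y. ?D y v)" for v using h by simp
  have conth: "continuous_on S h" using Ck_on_Suc_imp[OF h] by simp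
  have zS: "?z y t \<in> S" if "y \<in> S" "t \<in> {0..1}" for y t
    using convex_segment_point[OF S(2,3)] that by auto
  note int = segment_integrand_integrable[OF S(2,3)]
  have "linear (\<lambda>v. segment_moment c (Suc m) (\<lambda>z. ?D z v) x)"
  proof (rule linearI)
    fix u v :: 'e and r :: real
    have "segment_moment c (Suc m) (\<lambda>z. ?D z (u + v)) x
        = integral {0..1} (\<lambda>t. t ^ Suc m * ?D (?z x t) u + t ^ Suc m * ?D (?z x t) v)"
      unfolding segment_moment_def
      by (rule integral_cong) (simp add: linear_add[OF lin[OF zS[OF x]]] distrib_left)
    then show "segment_moment c (Suc m) (\<lambda>z. ?D z (u + v)) x
        = segment_moment c (Suc m) (\<lambda>z. ?D z u) x + segment_moment c (Suc m) (\<lambda>z. ?D z v) x"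
      unfolding segment_moment_def integral_add[OF int[OF cont x] int[OF cont x]] .
    have "segment_moment c (Suc m) (\<lambda>z. ?D z (r *\<^sub>R v)) x
        = integral {0..1} (\<lambda>t. r * (t ^ Suc m * ?D (?z x t) v))"
      unfolding segment_moment_def
      by (rule integral_cong) (simp add: linear_cmul[OF lin[OF zS[OF x]]])
    then show "segment_moment c (Suc m) (\<lambda>z. ?D z (r *\<^sub>R v)) x
        = r *\<^sub>R segment_moment c (Suc m) (\<lambda>z. ?D z v) x"
      unfolding segment_moment_def by simp
  qed
  then have bl: "bounded_linear (\<lambda>v. segment_moment c (Suc m) (\<lambda>z. ?D z v) x)"
    by (rule parseval_frame_bounded_linear[OF B])
  \<comment> \<open>\<open>M (y, t)\<close> bounds the operator norm of the difference between the derivatives of \<open>h\<close> at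
    the points with parameter \<open>t\<close> on the segments from \<open>c\<close> to \<open>y\<close> and to \<open>x\<close>.\<close>
  define M where "M = (\<lambda>(y, t). \<Sum>b\<in>B. norm b * \<bar>?D (?z y t) b - ?D (?z x t) b\<bar>)"
  have contM: "continuous_on (S \<times> {0..1}) M"
  proof -
    have "continuous_on (S \<times> {0..1}) (\<lambda>p. ?D (?z (fst p) (snd p)) b)"
      "continuous_on (S \<times> {0..1}) (\<lambda>p. ?D (?z x (snd p)) b)" for b
      using zS x by (auto intro!: continuous_on_compose2[OF cont[of b]] continuous_intros)
    then show ?thesis unfolding M_def split_beta by (intro continuous_intros)
  qed
  have "\<exists>d>0. \<forall>y. norm (y - x) < d \<longrightarrow>
      norm (segment_moment c m h y - segment_moment c m h x
        - segment_moment c (Suc m) (\<lambda>z. ?D z (y - x)) x) \<le> e * norm (y - x)" if e: "e > 0" for e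
  proof -
    obtain X0 where X0: "x \<in> X0" "open X0"
        "\<forall>y\<in>X0 \<inter> S. \<forall>t\<in>{0..1}. dist (M (y, t)) (M (x, t)) \<le> e"
      by (rule continuous_on_prod_compactE[OF contM compact_Icc x e])
    obtain d where d: "d > 0" "ball x d \<subseteq> X0 \<inter> S"
      using X0(1,2) S(1) x by (metis Int_iff open_Int openE)
    have "norm (segment_moment c m h y - segment_moment c m h x
        - segment_moment c (Suc m) (\<lambda>z. ?D z (y - x)) x) \<le> e * norm (y - x)" if y: "norm (y - x) < d" for y
    proof -
      have yS: "y \<in> S" using d y by (auto simp: dist_norm norm_minus_commute)
      have pt: "\<bar>h (?z y t) - h (?z x t) - t * ?D (?z x t) (y - x)\<bar> \<le> norm (y - x) * e" if t: "t \<in> {0..1}" for t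
      proof -
        have "norm (h (?z y t) - h (?z x t) - ?D (?z x t) (t *\<^sub>R (y - x))) \<le> norm (y - x) * e"
        proof (rule differentiable_bound_linearization[where S = "ball x d" and f = "\<lambda>y. h (?z y t)"
              and f' = "\<lambda>y v. ?D (?z y t) (t *\<^sub>R v)" and a = x and b = y])
          show "x + s *\<^sub>R (y - x) \<in> ball x d" if "s \<in> {0..1}" for s
            using convex_segment_point[OF convex_ball, of x x d y s] that d y
            by (auto simp: dist_norm norm_minus_commute)
          show "((\<lambda>y. h (?z y t)) has_derivative (\<lambda>v. ?D (?z w t) (t *\<^sub>R v))) (at w within ball x d)"
            if w: "w \<in> ball x d" for w
          proof -
            have wS: "w \<in> S" using w d by auto
            have "((\<lambda>y. ?z y t) has_derivative (\<lambda>v. t *\<^sub>R v)) (at w within ball x d)"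
              by (auto intro!: derivative_eq_intros)
            from has_derivative_compose[OF this D[OF zS[OF wS t]]] show ?thesis .
          qed
          show "onorm ((\<lambda>v. ?D (?z w t) (t *\<^sub>R v)) - (\<lambda>v. ?D (?z x t) (t *\<^sub>R v))) \<le> e"
            if w: "w \<in> ball x d" for w
          proof (rule onorm_bound)
            show "0 \<le> e" using e by simp
            have wS: "w \<in> X0 \<inter> S" using w d by auto
            fix v
            have "linear (\<lambda>v. ?D (?z w t) v - ?D (?z x t) v)"
              using lin[OF zS[OF _ t]] wS x by (intro linear_compose_sub) auto
            from parseval_frame_linear_bound[OF B this, of "t *\<^sub>R v"]
            have "\<bar>?D (?z w t) (t *\<^sub>R v) - ?D (?z x t) (t *\<^sub>R v)\<bar> \<le> norm (t *\<^sub>R v) * M (w, t)"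
              by (simp add: M_def)
            also have "\<dots> \<le> norm v * e"
            proof (rule mult_mono)
              have "dist (M (w, t)) (M (x, t)) \<le> e" using X0(3) wS t by blast
              moreover have "M (x, t) = 0" by (simp add: M_def)
              ultimately show "M (w, t) \<le> e" by (simp add: dist_real_def)
              show "norm (t *\<^sub>R v) \<le> norm v" using t by (auto intro: mult_left_le_one_le)
              show "0 \<le> M (w, t)" by (simp add: M_def sum_nonneg)
            qed simp
            finally show "norm (((\<lambda>v. ?D (?z w t) (t *\<^sub>R v)) - (\<lambda>v. ?D (?z x t) (t *\<^sub>R v))) v) \<le> e * norm v"
              by (simp add: mult.commute)
          qed
        qed (use d in auto)
        then show ?thesis by (simp add: linear_cmul[OF lin[OF zS[OF x t]]])
      qed
      let ?F = "\<lambda>t. t ^ m * h (?z y t) - t ^ m * h (?z x t) - t ^ Suc m * ?D (?z x t) (y - x)"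
      have "segment_moment c m h y - segment_moment c m h x - segment_moment c (Suc m) (\<lambda>z. ?D z (y - x)) x
          = integral {0..1} ?F"
        unfolding segment_moment_def
        by (simp only: integral_diff int[OF conth yS] int[OF conth x] int[OF cont x] integrable_diff)
      also have "norm (integral {0..1} ?F) \<le> integral {0..1} (\<lambda>t::real. norm (y - x) * e)"
      proof (rule integral_norm_bound_integral)
        show "?F integrable_on {0..1}"
          by (intro integrable_diff int[OF conth yS] int[OF conth x] int[OF cont x])
        show "norm (?F t) \<le> norm (y - x) * e" if t: "t \<in> {0..1}" for t
        proof -
          have "?F t = t ^ m * (h (?z y t) - h (?z x t) - t * ?D (?z x t) (y - x))"
            by (simp add: algebra_simps)
          then have "norm (?F t) = t ^ m * \<bar>h (?z y t) - h (?z x t) - t * ?D (?z x t) (y - x)\<bar>"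
            using t by (simp add: abs_mult)
          also have "\<dots> \<le> 1 * (norm (y - x) * e)"
            using t pt[OF t] by (intro mult_mono) (auto intro: power_le_one)
          finally show ?thesis by simp
        qed
      qed auto
      finally show ?thesis by (simp add: mult.commute)
    qed
    then show ?thesis using d(1) by blast
  qed
  then show ?thesis unfolding has_derivative_at_alt using bl by blast
qed

lemma Ck_on_segment_moment:
  fixes h :: "'e::real_inner \<Rightarrow> real" and B :: "'e set"
  assumes B: "parseval_frame B" and S: "open S" "convex S" "c \<in> S"
  shows "Ck_on k h S \<Longrightarrow> Ck_on k (segment_moment c m h) S"
proof (induction k arbitrary: h m)
  case 0
  then show ?case
    using integral_continuous_on_param[of S 0 1 "\<lambda>x t. t ^ m * h (c + t *\<^sub>R (x - c))"]
      continuous_on_segment_integrand[OF S(2,3), of h m]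
    by (simp add: segment_moment_def[abs_def])
next
  case (Suc k)
  have h1: "Ck_on (Suc 0) h S" by (rule Ck_on_antimono[OF _ Suc.prems]) simp
  show ?case
  proof (rule Ck_on_SucI[OF S(1)])
    show "(segment_moment c m h has_derivative
      (\<lambda>v. segment_moment c (Suc m) (\<lambda>z. frechet_derivative h (at z) v) x)) (at x)" if "x \<in> S" for x
      by (rule segment_moment_has_derivative[OF B S h1 that])
    show "Ck_on k (segment_moment c (Suc m) (\<lambda>z. frechet_derivative h (at z) v)) S" for v
      using Suc by auto
  qed
qed

text \<open>The functions \<open>g b\<close> are the means of the partial derivatives over the segment from \<open>c\<close> to \<open>x\<close>, and
the formula is the fundamental theorem of calculus along that segment.\<close>

lemma Hadamard:
  fixes f :: "'e::real_inner \<Rightarrow> real" and B :: "'e set"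
  assumes B: "parseval_frame B" and S: "open S" "convex S" "c \<in> S" and f: "smooth_on f S"
  obtains g where "\<And>b. smooth_on (g b) S" "\<And>b. g b c = frechet_derivative f (at c) b"
    "\<And>x. x \<in> S \<Longrightarrow> f x = f c + (\<Sum>b\<in>B. ((x - c) \<bullet> b) * g b x)"
proof
  let ?D = "\<lambda>y. frechet_derivative f (at y)"
  let ?g = "\<lambda>b. segment_moment c 0 (\<lambda>y. ?D y b)"
  have f1: "Ck_on (Suc k) f S" for k using f by (simp add: smooth_on_def)
  show "smooth_on (?g b) S" for b
    unfolding smooth_on_def using f1 by (intro allI Ck_on_segment_moment[OF B S]) auto
  show "?g b c = ?D c b" for b by (simp add: segment_moment_def)
  fix x assume x: "x \<in> S"
  let ?z = "\<lambda>t. c + t *\<^sub>R (x - c)"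
  have z: "?z t \<in> S" if "t \<in> {0..1}" for t using convex_segment_point[OF S(2,3) x] that by auto
  have "((\<lambda>t. f (?z t)) has_vector_derivative ?D (?z t) (x - c)) (at t within {0..1})"
    if t: "t \<in> {0..1}" for t
  proof -
    have "(?z has_derivative (\<lambda>s. s *\<^sub>R (x - c))) (at t within {0..1})"
      by (auto intro!: derivative_eq_intros)
    from has_derivative_compose[OF this Ck_on_has_derivative[OF f1[of 0] z[OF t]]]
    show ?thesis
      unfolding has_vector_derivative_def
      by (simp add: linear_cmul[OF has_derivative_linear[OF Ck_on_has_derivative[OF f1[of 0] z[OF t]]]])
  qed
  from fundamental_theorem_of_calculus[OF zero_le_one this]
  have "((\<lambda>t. ?D (?z t) (x - c)) has_integral f x - f c) {0..1}" by simp
  then have "f x - f c = integral {0..1} (\<lambda>t. ?D (?z t) (x - c))" by (simp add: integral_unique)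
  also have "\<dots> = integral {0..1} (\<lambda>t. \<Sum>b\<in>B. ((x - c) \<bullet> b) * (t ^ 0 * ?D (?z t) b))"
  proof (rule integral_cong)
    fix t :: real assume "t \<in> {0..1}"
    from parseval_frame_expand_linear[OF B has_derivative_linear[OF Ck_on_has_derivative[OF f1[of 0] z[OF this]]], of "x - c"]
    show "?D (?z t) (x - c) = (\<Sum>b\<in>B. ((x - c) \<bullet> b) * (t ^ 0 * ?D (?z t) b))" by simp
  qed
  also have "\<dots> = (\<Sum>b\<in>B. integral {0..1} (\<lambda>t. ((x - c) \<bullet> b) * (t ^ 0 * ?D (?z t) b)))"
  proof (rule integral_sum)
    show "finite B" using B by (simp add: parseval_frame_def)
    have "continuous_on S (\<lambda>y. ?D y b)" for b using f1[of 0] by simp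
    from segment_integrand_integrable[OF S(2,3) this x]
    show "(\<lambda>t. ((x - c) \<bullet> b) * (t ^ 0 * ?D (?z t) b)) integrable_on {0..1}" for b
      by (rule integrable_on_mult_right)
  qed
  finally show "f x = f c + (\<Sum>b\<in>B. ((x - c) \<bullet> b) * ?g b x)"
    by (simp add: segment_moment_def)
qed

section \<open>Balls in the model space and extension by zero\<close>

text \<open>The coordinates of the points of a ball are bounded, so the ball is a closed subset of a
continuous image of a cube.\<close>

lemma compact_cball_model:
  fixes B :: "'e::real_inner set"
  assumes B: "parseval_frame B" shows "compact (cball (c :: 'e) r)"
proof -
  have fin: "finite B" using B by (simp add: parseval_frame_def)
  have box: "\<exists>K :: 'e set. compact K \<and> (\<forall>a. (\<forall>b\<in>F. \<bar>a b\<bar> \<le> R) \<longrightarrow> (\<Sum>b\<in>F. a b *\<^sub>R b) \<in> K)"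
    if "finite F" for F :: "'e set" and R :: real
    using that
  proof (induction F rule: finite_induct)
    case empty
    then show ?case by (intro exI[of _ "{0}"]) auto
  next
    case (insert b F)
    then obtain K where K: "compact K" "\<And>a. \<forall>b\<in>F. \<bar>a b\<bar> \<le> R \<Longrightarrow> (\<Sum>b\<in>F. a b *\<^sub>R b) \<in> K" by blast
    let ?K = "(\<lambda>(s, y). s *\<^sub>R b + y) ` ({-R..R} \<times> K)"
    have "compact ?K"
      by (intro compact_continuous_image compact_Times K(1) compact_Icc)
        (auto intro!: continuous_intros simp: split_beta)
    moreover have "(\<Sum>b\<in>insert b F. a b *\<^sub>R b) \<in> ?K" if a: "\<forall>b\<in>insert b F. \<bar>a b\<bar> \<le> R" for a
    proof
      show "(\<Sum>b\<in>insert b F. a b *\<^sub>R b) = (case (a b, \<Sum>b\<in>F. a b *\<^sub>R b) of (s, y) \<Rightarrow> s *\<^sub>R b + y)"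
        using insert by simp
      show "(a b, \<Sum>b\<in>F. a b *\<^sub>R b) \<in> {-R..R} \<times> K" using a K(2) by auto
    qed
    ultimately show ?case by blast
  qed
  obtain K :: "'e set" where K: "compact K"
      "\<And>a. \<forall>b\<in>B. \<bar>a b\<bar> \<le> (norm c + r) * (\<Sum>b\<in>B. norm b) \<Longrightarrow> (\<Sum>b\<in>B. a b *\<^sub>R b) \<in> K"
    using box[OF fin, of "(norm c + r) * (\<Sum>b\<in>B. norm b)"] by blast
  have "x \<in> K" if x: "x \<in> cball c r" for x
  proof -
    have "norm x \<le> norm c + r"
      using x norm_triangle_ineq2[of x c] by (simp add: dist_norm norm_minus_commute)
    then have "\<bar>x \<bullet> b\<bar> \<le> (norm c + r) * (\<Sum>b\<in>B. norm b)" if "b \<in> B" for b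
      using Cauchy_Schwarz_ineq2[of x b] member_le_sum[OF that _ fin, of norm]
        mult_mono[of "norm x" "norm c + r" "norm b" "\<Sum>b\<in>B. norm b"] norm_ge_zero[of x]
      by fastforce
    then have "(\<Sum>b\<in>B. (x \<bullet> b) *\<^sub>R b) \<in> K" by (intro K(2)) auto
    then show "x \<in> K" using B by (metis parseval_frame_def)
  qed
  then have "cball c r = K \<inter> cball c r" by auto
  then show ?thesis using compact_Int_closed[OF K(1) closed_cball] by metis
qed

text \<open>Extension by zero: \<open>h\<close> may take arbitrary values outside of \<open>O'\<close>.\<close>

lemma smooth_on_bump_mult:
  assumes O: "open O'" "cball c r \<subseteq> O'" and r: "r > 0" and h: "smooth_on h O'"
  shows "smooth_on (\<lambda>x. bump c r x * h x) UNIV"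
  unfolding smooth_on_def
proof (intro allI Ck_on_local)
  fix k x
  show "\<exists>T. open T \<and> x \<in> T \<and> Ck_on k (\<lambda>x. bump c r x * h x) T"
  proof (cases "x \<in> O'")
    case True
    then show ?thesis
      using O(1) h by (intro exI[of _ O']) (auto simp: smooth_on_def intro!: Ck_on_mult Ck_on_bump)
  next
    case False
    have "Ck_on k (\<lambda>x. bump c r x * h x) (- cball c r)"
    proof (rule Ck_on_cong[OF _ _ Ck_on_const[of _ _ 0]])
      show "0 = bump c r y * h y" if "y \<in> - cball c r" for y
        using that bump_nonzero_iff[OF r, of c y] by auto
    qed auto
    then show ?thesis using False O by (intro exI[of _ "- cball c r"]) auto
  qed
qed

lemma bump_outside: "r > 0 \<Longrightarrow> r \<le> dist c x \<Longrightarrow> bump c r x = 0"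
  using bump_nonzero_iff[of r c x] by auto

section \<open>Smooth functions and tangent vectors on a manifold\<close>

locale manifold =
  fixes \<A> :: "('a::{t2_space, second_countable_topology}, 'e::real_inner) chart set"
  assumes smooth_manifold: "smooth_manifold \<A>"
begin

abbreviation "SF \<equiv> smooth_functions \<A>"
abbreviation "VF \<equiv> vector_fields \<A>"
abbreviation "T \<equiv> tangent_space \<A>"

lemma chartD:
  assumes "(U, \<phi>) \<in> \<A>"
  shows "open U" "open (\<phi> ` U)" "inj_on \<phi> U" "continuous_on U \<phi>" "continuous_on (\<phi> ` U) (inv_into U \<phi>)"
    "\<And>m. m \<in> U \<Longrightarrow> inv_into U \<phi> (\<phi> m) = m"
proof -
  have "is_chart (U, \<phi>)"
    using assms smooth_manifold by (auto simp: smooth_manifold_def smooth_atlas_def)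
  then have h: "open U" "open (\<phi> ` U)" "homeomorphism U (\<phi> ` U) \<phi> (inv_into U \<phi>)"
    by (auto simp: is_chart_def)
  then show "open U" "open (\<phi> ` U)" "continuous_on U \<phi>" "continuous_on (\<phi> ` U) (inv_into U \<phi>)"
    by (auto simp: homeomorphism_def)
  show i: "\<And>m. m \<in> U \<Longrightarrow> inv_into U \<phi> (\<phi> m) = m" using h by (auto simp: homeomorphism_def)
  then show "inj_on \<phi> U" by (metis inj_onI)
qed

lemma chart_open_image:
  assumes "(U, \<phi>) \<in> \<A>" "open W" "W \<subseteq> U" shows "open (\<phi> ` W)"
proof -
  have "\<phi> ` W = inv_into U \<phi> -` W \<inter> \<phi> ` U"
    using assms(3) chartD(6)[OF assms(1)] by auto
  then show ?thesis
    using chartD(2,5)[OF assms(1)] assms(2) by (simp add: continuous_on_open_vimage)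
qed

lemma chart_around: obtains U \<phi> where "(U, \<phi>) \<in> \<A>" "p \<in> U"
  using smooth_manifold unfolding smooth_manifold_def smooth_atlas_def by blast

lemma smooth_function_chart: "f \<in> SF \<Longrightarrow> (U, \<phi>) \<in> \<A> \<Longrightarrow> smooth_on (\<lambda>y. f (inv_into U \<phi> y)) (\<phi> ` U)"
  by (auto simp: smooth_functions_def o_def)

lemma smooth_function_I: "(\<And>U \<phi>. (U, \<phi>) \<in> \<A> \<Longrightarrow> smooth_on (\<lambda>y. f (inv_into U \<phi> y)) (\<phi> ` U)) \<Longrightarrow> f \<in> SF"
  by (auto simp: smooth_functions_def o_def)

lemma smooth_function_const: "(\<lambda>_. r) \<in> SF"
  by (rule smooth_function_I) (auto simp: smooth_on_def intro!: Ck_on_const chartD(2))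

lemma smooth_function_add: "f \<in> SF \<Longrightarrow> g \<in> SF \<Longrightarrow> (\<lambda>x. f x + g x) \<in> SF"
  by (rule smooth_function_I) (use smooth_function_chart[of f] smooth_function_chart[of g] in \<open>auto simp: smooth_on_def intro!: Ck_on_add chartD(2)\<close>)

lemma smooth_function_mult: "f \<in> SF \<Longrightarrow> g \<in> SF \<Longrightarrow> (\<lambda>x. f x * g x) \<in> SF"
  by (rule smooth_function_I) (use smooth_function_chart[of f] smooth_function_chart[of g] in \<open>auto simp: smooth_on_def intro!: Ck_on_mult chartD(2)\<close>)

lemma smooth_function_cmult: "f \<in> SF \<Longrightarrow> (\<lambda>x. r * f x) \<in> SF"
  by (rule smooth_function_mult[OF smooth_function_const])

lemma smooth_function_diff: "f \<in> SF \<Longrightarrow> g \<in> SF \<Longrightarrow> (\<lambda>x. f x - g x) \<in> SF"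
  using smooth_function_add[OF _ smooth_function_cmult[of g "-1"], of f] by simp

lemma smooth_function_sum: "(\<And>i. i \<in> I \<Longrightarrow> f i \<in> SF) \<Longrightarrow> (\<lambda>x. \<Sum>i\<in>I. f i x) \<in> SF"
proof (induction I rule: infinite_finite_induct)
  case (insert i I)
  then show ?case using smooth_function_add[of "f i"] by simp
qed (simp_all add: smooth_function_const)

definition pull :: "'a set \<Rightarrow> ('a \<Rightarrow> 'e) \<Rightarrow> ('e \<Rightarrow> real) \<Rightarrow> 'a \<Rightarrow> real" where
  "pull U \<phi> k m = (if m \<in> U then k (\<phi> m) else 0)"

lemma parseval_frame_model: "\<exists>B :: 'e set. parseval_frame B"
  using smooth_manifold parseval_frame_exists unfolding smooth_manifold_def by blast

text \<open>At points of the chart domain, smoothness is that of the transition maps. At other points, the compact set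
on which the pullback may be nonzero is closed because the manifold is Hausdorff, so the pullback vanishes nearby.\<close>

lemma smooth_function_pull:
  assumes U: "(U, \<phi>) \<in> \<A>" and ball: "cball c r \<subseteq> \<phi> ` U"
    and k: "smooth_on k UNIV" and k0: "\<And>x. x \<notin> cball c r \<Longrightarrow> k x = 0"
  shows "pull U \<phi> k \<in> SF"
proof (rule smooth_function_I, unfold smooth_on_def, intro allI Ck_on_local)
  fix V \<psi> n y assume V: "(V, \<psi>) \<in> \<A>" and "y \<in> \<psi> ` V"
  then obtain m where m: "m \<in> V" "y = \<psi> m" by blast
  obtain B :: "'e set" where B: "parseval_frame B" using parseval_frame_model by blast
  let ?i = "inv_into V \<psi>"
  show "\<exists>T. open T \<and> y \<in> T \<and> Ck_on n (\<lambda>y. pull U \<phi> k (?i y)) T"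
  proof (cases "m \<in> U")
    case True
    have op: "open (\<psi> ` (V \<inter> U))"
      using chart_open_image[OF V] chartD(1)[OF U] chartD(1)[OF V] by blast
    have tr: "smooth_on (\<lambda>y. \<phi> (?i y)) (\<psi> ` (V \<inter> U))"
      using U V smooth_manifold unfolding smooth_manifold_def smooth_atlas_def o_def by fastforce
    have "Ck_on n (\<lambda>y. k (\<phi> (?i y))) (\<psi> ` (V \<inter> U))"
      by (rule Ck_on_comp[OF B op subset_UNIV]) (use tr k in \<open>auto simp: smooth_on_def\<close>)
    then have "Ck_on n (\<lambda>y. pull U \<phi> k (?i y)) (\<psi> ` (V \<inter> U))"
      by (rule Ck_on_cong[OF op, rotated]) (auto simp: pull_def chartD(6)[OF V])
    then show ?thesis using op m True by blast
  next
    case False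
    define K where "K = inv_into U \<phi> ` cball c r"
    have "compact K" unfolding K_def
      by (rule compact_continuous_image[OF continuous_on_subset[OF chartD(5)[OF U] ball]
            compact_cball_model[OF B]])
    then have op: "open (\<psi> ` (V - K))"
      by (intro chart_open_image[OF V] open_Diff chartD(1)[OF V] compact_imp_closed) auto
    have "K \<subseteq> U" using ball by (auto simp: K_def inv_into_into)
    then have y: "y \<in> \<psi> ` (V - K)" using m False by auto
    have "Ck_on n (\<lambda>y. pull U \<phi> k (?i y)) (\<psi> ` (V - K))"
    proof (rule Ck_on_cong[OF op _ Ck_on_const[OF op, of _ 0]])
      fix z assume "z \<in> \<psi> ` (V - K)"
      then obtain m' where m': "m' \<in> V" "m' \<notin> K" "z = \<psi> m'" by blast
      have "k (\<phi> m') = 0" if "m' \<in> U"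
      proof (rule k0)
        show "\<phi> m' \<notin> cball c r"
          using m'(2) chartD(6)[OF U that] unfolding K_def by (metis imageI)
      qed
      then show "0 = pull U \<phi> k (?i z)" using m' by (simp add: pull_def chartD(6)[OF V])
    qed
    then show ?thesis using op y by blast
  qed
qed

lemma smooth_function_pull_bump:
  assumes "(U, \<phi>) \<in> \<A>" "cball c r \<subseteq> \<phi> ` U" "r > 0" "open O'" "cball c r \<subseteq> O'" "smooth_on h O'"
  shows "pull U \<phi> (\<lambda>y. bump c r y * h y) \<in> SF"
proof (rule smooth_function_pull[OF assms(1,2)])
  show "smooth_on (\<lambda>y. bump c r y * h y) UNIV"
    by (rule smooth_on_bump_mult) fact+
  show "bump c r y * h y = 0" if "y \<notin> cball c r" for y
    using that bump_outside[OF assms(3), of c y] by simp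
qed

lemma tangentD:
  assumes "v \<in> T p"
  shows "f \<in> SF \<Longrightarrow> g \<in> SF \<Longrightarrow> v (\<lambda>x. f x + g x) = v f + v g"
    "f \<in> SF \<Longrightarrow> g \<in> SF \<Longrightarrow> v (\<lambda>x. f x * g x) = v f * g p + f p * v g"
    "f \<in> SF \<Longrightarrow> v (\<lambda>x. r * f x) = r * v f"
    "f \<notin> SF \<Longrightarrow> v f = 0"
  using assms by (auto simp: tangent_space_def)

lemma tangentI:
  assumes "\<And>f g. f \<in> SF \<Longrightarrow> g \<in> SF \<Longrightarrow> v (\<lambda>x. f x + g x) = v f + v g"
    "\<And>f g. f \<in> SF \<Longrightarrow> g \<in> SF \<Longrightarrow> v (\<lambda>x. f x * g x) = v f * g p + f p * v g"
    "\<And>f r. f \<in> SF \<Longrightarrow> v (\<lambda>x. r * f x) = r * v f"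
    "\<And>f. f \<notin> SF \<Longrightarrow> v f = 0"
  shows "v \<in> T p"
  using assms by (auto simp: tangent_space_def)

lemma tangent_zero: "(\<lambda>f. 0) \<in> T p"
  by (rule tangentI) auto

lemma tangent_add: "v \<in> T p \<Longrightarrow> w \<in> T p \<Longrightarrow> (\<lambda>f. v f + w f) \<in> T p"
  by (rule tangentI) (simp_all add: tangentD algebra_simps)

lemma tangent_scale: "v \<in> T p \<Longrightarrow> (\<lambda>f. r * v f) \<in> T p"
  by (rule tangentI) (simp_all add: tangentD algebra_simps)

lemma tangent_diff:
  assumes "v \<in> T p" "f \<in> SF" "g \<in> SF" shows "v (\<lambda>x. f x - g x) = v f - v g"
  using tangentD(1)[OF assms(1,2) smooth_function_cmult[OF assms(3), of "-1"]] tangentD(3)[OF assms(1,3), of "-1"]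
  by simp

lemma tangent_const: assumes "v \<in> T p" shows "v (\<lambda>x. r) = 0"
proof -
  have "v (\<lambda>x. 1) = 0" using tangentD(2)[OF assms smooth_function_const[of 1] smooth_function_const[of 1]] by simp
  then show ?thesis using tangentD(3)[OF assms smooth_function_const[of 1], of r] by simp
qed

lemma tangent_sum:
  assumes v: "v \<in> T p" and f: "\<And>i. i \<in> I \<Longrightarrow> f i \<in> SF"
  shows "v (\<lambda>x. \<Sum>i\<in>I. f i x) = (\<Sum>i\<in>I. v (f i))"
  using f
proof (induction I rule: infinite_finite_induct)
  case (insert i I)
  then show ?case using tangentD(1)[OF v, of "f i" "\<lambda>x. \<Sum>i\<in>I. f i x"] by (simp add: smooth_function_sum)
qed (simp_all add: tangent_const[OF v])

lemma vector_field_D: "X \<in> VF \<Longrightarrow> X p \<in> T p" "X \<in> VF \<Longrightarrow> f \<in> SF \<Longrightarrow> (\<lambda>p. X p f) \<in> SF"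
  by (auto simp: vector_fields_def)

lemma vector_field_zero: "(\<lambda>p f. 0) \<in> VF"
  by (simp add: vector_fields_def tangent_zero smooth_function_const)

lemma vector_field_add: "X \<in> VF \<Longrightarrow> Y \<in> VF \<Longrightarrow> (\<lambda>p f. X p f + Y p f) \<in> VF"
  by (simp add: vector_fields_def tangent_add smooth_function_add)

lemma vector_field_smult: "a \<in> SF \<Longrightarrow> X \<in> VF \<Longrightarrow> (\<lambda>p f. a p * X p f) \<in> VF"
  by (simp add: vector_fields_def tangent_scale smooth_function_mult)

lemma vector_field_sum: "(\<And>i. i \<in> I \<Longrightarrow> X i \<in> VF) \<Longrightarrow> (\<lambda>p f. \<Sum>i\<in>I. X i p f) \<in> VF"
proof (induction I rule: infinite_finite_induct)
  case (insert i I)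
  then show ?case using vector_field_add[of "X i"] by simp
qed (simp_all add: vector_field_zero)

section \<open>Local frames\<close>

text \<open>The partial derivative in direction \<open>b\<close>, multiplied by a bump function. The value on functions
that are not smooth is the one that tangent vectors have there by convention.\<close>

definition coord_field :: "'a set \<Rightarrow> ('a \<Rightarrow> 'e) \<Rightarrow> 'e \<Rightarrow> real \<Rightarrow> 'e \<Rightarrow> 'a vector_field" where
  "coord_field U \<phi> c r b m f =
     (if f \<in> SF then pull U \<phi> (\<lambda>y. bump c r y * frechet_derivative (\<lambda>y. f (inv_into U \<phi> y)) (at y) b) m else 0)"

lemma coord_field_vector_field:
  assumes U: "(U, \<phi>) \<in> \<A>" and r: "r > 0" "cball c r \<subseteq> \<phi> ` U"
  shows "coord_field U \<phi> c r b \<in> VF"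
proof -
  let ?i = "inv_into U \<phi>"
  let ?D = "\<lambda>f y. frechet_derivative (\<lambda>y. f (?i y)) (at y)"
  have C: "Ck_on (Suc n) (\<lambda>y. f (?i y)) (\<phi> ` U)" if "f \<in> SF" for f n
    using smooth_function_chart[OF that U] by (simp add: smooth_on_def)
  have D: "((\<lambda>y. f (?i y)) has_derivative ?D f y) (at y)" if "f \<in> SF" "y \<in> \<phi> ` U" for f y
    using Ck_on_has_derivative[OF C[OF that(1)] that(2)] .
  have "coord_field U \<phi> c r b m \<in> T m" for m
  proof (cases "m \<in> U")
    case False
    then have "coord_field U \<phi> c r b m = (\<lambda>f. 0)" by (auto simp: coord_field_def pull_def)
    then show ?thesis by (simp add: tangent_zero)
  next
    case True
    then have y: "\<phi> m \<in> \<phi> ` U" by blast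
    note E = D[OF _ y]
    show ?thesis
    proof (rule tangentI)
      fix f g assume fg: "f \<in> SF" "g \<in> SF"
      have "?D (\<lambda>x. f x + g x) (\<phi> m) = (\<lambda>v. ?D f (\<phi> m) v + ?D g (\<phi> m) v)"
        by (rule frechet_derivative_at[symmetric, OF has_derivative_add[OF E[OF fg(1)] E[OF fg(2)]]])
      then show "coord_field U \<phi> c r b m (\<lambda>x. f x + g x)
          = coord_field U \<phi> c r b m f + coord_field U \<phi> c r b m g"
        using fg by (simp add: coord_field_def pull_def smooth_function_add True distrib_left)
      have "?D (\<lambda>x. f x * g x) (\<phi> m) = (\<lambda>v. f m * ?D g (\<phi> m) v + ?D f (\<phi> m) v * g m)"
        using frechet_derivative_at[symmetric, OF has_derivative_mult[OF E[OF fg(1)] E[OF fg(2)]]]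
        by (simp add: chartD(6)[OF U True])
      then show "coord_field U \<phi> c r b m (\<lambda>x. f x * g x)
          = coord_field U \<phi> c r b m f * g m + f m * coord_field U \<phi> c r b m g"
        using fg by (simp add: coord_field_def pull_def smooth_function_mult True algebra_simps)
    next
      fix f a assume f: "f \<in> SF"
      have "?D (\<lambda>x. a * f x) (\<phi> m) = (\<lambda>v. a * ?D f (\<phi> m) v)"
        by (rule frechet_derivative_at[symmetric, OF has_derivative_mult_right[OF E[OF f]]])
      then show "coord_field U \<phi> c r b m (\<lambda>x. a * f x) = a * coord_field U \<phi> c r b m f"
        using f by (simp add: coord_field_def pull_def smooth_function_cmult True)
    qed (simp add: coord_field_def)
  qed
  moreover have "(\<lambda>m. coord_field U \<phi> c r b m f) \<in> SF" if f: "f \<in> SF" for f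
  proof -
    have "smooth_on (\<lambda>y. ?D f y b) (\<phi> ` U)" using C[OF f] by (simp add: smooth_on_def)
    from smooth_function_pull_bump[OF U r(2,1) chartD(2)[OF U] r(2) this]
    have "pull U \<phi> (\<lambda>y. bump c r y * ?D f y b) \<in> SF" .
    then show ?thesis using f by (simp add: coord_field_def)
  qed
  ultimately show ?thesis by (simp add: vector_fields_def)
qed

text \<open>A derivation \<open>v\<close> at \<open>q\<close> acts on global functions only, so coordinates enter through
their cut-off versions \<open>x b\<close>. By the Leibniz rule, \<open>v (x b) - (\<phi> q \<bullet> b) v \<psi>\<close> is \<open>\<psi> q\<close> times the
value that \<open>v\<close> should have on the coordinate \<open>b\<close>. The formula results from applying \<open>v\<close> to Hadamard's
expansion of \<open>f\<close> around \<open>q\<close>, multiplied by \<open>\<psi>\<^sup>2\<close> to make each of its terms a product of global functions.\<close>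

lemma derivation_in_coordinates:
  fixes B :: "'e set"
  assumes U: "(U, \<phi>) \<in> \<A>" and r: "0 < r" "r < R" "cball c R \<subseteq> \<phi> ` U" and B: "parseval_frame B"
    and q: "q \<in> U" "dist c (\<phi> q) < r" and v: "v \<in> T q" and f: "f \<in> SF"
  defines "\<psi> \<equiv> pull U \<phi> (bump c r)"
    and "x \<equiv> \<lambda>b. pull U \<phi> (\<lambda>y. bump c r y * (y \<bullet> b))"
  shows "\<psi> q ^ 2 * v f = (\<Sum>b\<in>B. (v (x b) - (\<phi> q \<bullet> b) * v \<psi>) * coord_field U \<phi> c r b q f)"
proof -
  let ?y = "\<phi> q" and ?F = "\<lambda>y. f (inv_into U \<phi> y)" and ?O = "ball c R"
  have rO: "cball c r \<subseteq> ?O" "cball c r \<subseteq> \<phi> ` U" "?O \<subseteq> \<phi> ` U" using r by auto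
  have sm: "smooth_on ?F ?O"
    using smooth_function_chart[OF f U] rO(3) Ck_on_subset unfolding smooth_on_def by blast
  have yO: "?y \<in> ?O" using q r by auto
  obtain g where g: "\<And>b. smooth_on (g b) ?O" "\<And>b. g b ?y = frechet_derivative ?F (at ?y) b"
      "\<And>z. z \<in> ?O \<Longrightarrow> ?F z = ?F ?y + (\<Sum>b\<in>B. ((z - ?y) \<bullet> b) * g b z)"
    using Hadamard[OF B open_ball convex_ball yO sm] by metis
  define G where "G = (\<lambda>b. pull U \<phi> (\<lambda>y. bump c r y * g b y))"
  have pullSF: "pull U \<phi> (\<lambda>y. bump c r y * h y) \<in> SF" if "smooth_on h ?O" for h
    by (rule smooth_function_pull_bump[OF U rO(2) r(1) open_ball rO(1) that])
  have GSF: "G b \<in> SF" for b unfolding G_def by (rule pullSF[OF g(1)])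
  have "smooth_on (\<lambda>y. 1) ?O" by (auto simp: smooth_on_def intro: Ck_on_const)
  from pullSF[OF this] have psiSF: "\<psi> \<in> SF" by (simp add: \<psi>_def)
  have "smooth_on (\<lambda>y. y \<bullet> b) ?O" for b
    by (auto simp: smooth_on_def intro: Ck_on_linear bounded_linear_inner_left)
  from pullSF[OF this] have xSF: "x b \<in> SF" for b by (simp add: x_def)
  have x0SF: "(\<lambda>m. x b m - (?y \<bullet> b) * \<psi> m) \<in> SF" for b
    by (intro smooth_function_diff smooth_function_cmult xSF psiSF)
  \<comment> \<open>Hadamard's expansion multiplied by \<open>\<psi>\<^sup>2\<close>, as an identity of global functions: where it is
    not available, \<open>\<psi>\<close> and all the \<open>x b\<close> vanish.\<close>
  have id: "(\<lambda>m. (\<psi> m * \<psi> m) * f m)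
      = (\<lambda>m. f q * (\<psi> m * \<psi> m) + (\<Sum>b\<in>B. (x b m - (?y \<bullet> b) * \<psi> m) * G b m))"
  proof
    fix m
    show "(\<psi> m * \<psi> m) * f m = f q * (\<psi> m * \<psi> m) + (\<Sum>b\<in>B. (x b m - (?y \<bullet> b) * \<psi> m) * G b m)"
    proof (cases "m \<in> U \<and> \<phi> m \<in> ?O")
      case True
      have "f m = f q + (\<Sum>b\<in>B. ((\<phi> m - ?y) \<bullet> b) * g b (\<phi> m))"
        using g(3)[of "\<phi> m"] True q(1) by (simp add: chartD(6)[OF U])
      moreover have "(x b m - (?y \<bullet> b) * \<psi> m) * G b m = (\<psi> m * \<psi> m) * (((\<phi> m - ?y) \<bullet> b) * g b (\<phi> m))" for b
        using True by (simp add: x_def \<psi>_def G_def pull_def inner_diff_left algebra_simps)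
      ultimately show ?thesis by (simp add: distrib_left flip: sum_distrib_left)
    next
      case False
      then have "m \<notin> U \<or> bump c r (\<phi> m) = 0"
        using bump_nonzero_iff[OF r(1), of c "\<phi> m"] r(2) by auto
      then have "\<psi> m = 0" "x b m = 0" for b by (auto simp: \<psi>_def x_def pull_def)
      then show ?thesis by simp
    qed
  qed
  \<comment> \<open>One factor of each product vanishes at \<open>q\<close>, so the Leibniz rule leaves a single term.\<close>
  have xq: "x b q - (?y \<bullet> b) * \<psi> q = 0" for b
    using q(1) by (simp add: x_def \<psi>_def pull_def)
  have "v (\<lambda>m. (\<psi> m * \<psi> m) * f m) = v (\<lambda>m. \<psi> m * \<psi> m) * f q + \<psi> q ^ 2 * v f"
    using tangentD(2)[OF v smooth_function_mult[OF psiSF psiSF] f] by (simp add: power2_eq_square)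
  moreover have "v (\<lambda>m. f q * (\<psi> m * \<psi> m) + (\<Sum>b\<in>B. (x b m - (?y \<bullet> b) * \<psi> m) * G b m))
     = f q * v (\<lambda>m. \<psi> m * \<psi> m) + (\<Sum>b\<in>B. v (\<lambda>m. (x b m - (?y \<bullet> b) * \<psi> m) * G b m))"
    by (subst tangentD(1)[OF v]; (intro smooth_function_cmult smooth_function_mult smooth_function_sum psiSF x0SF GSF)?)
      (simp add: tangentD(3)[OF v smooth_function_mult[OF psiSF psiSF]] tangent_sum[OF v] smooth_function_mult x0SF GSF)
  moreover have "v (\<lambda>m. (x b m - (?y \<bullet> b) * \<psi> m) * G b m)
      = (v (x b) - (?y \<bullet> b) * v \<psi>) * coord_field U \<phi> c r b q f" for b
  proof -
    have "v (\<lambda>m. (x b m - (?y \<bullet> b) * \<psi> m) * G b m) = v (\<lambda>m. x b m - (?y \<bullet> b) * \<psi> m) * G b q"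
      using tangentD(2)[OF v x0SF[of b] GSF[of b]] xq[of b] by simp
    also have "v (\<lambda>m. x b m - (?y \<bullet> b) * \<psi> m) = v (x b) - (?y \<bullet> b) * v \<psi>"
      by (simp add: tangent_diff[OF v xSF smooth_function_cmult[OF psiSF]] tangentD(3)[OF v psiSF])
    also have "G b q = coord_field U \<phi> c r b q f"
      using f q(1) by (simp add: G_def coord_field_def pull_def g(2))
    finally show ?thesis .
  qed
  ultimately show ?thesis using id by simp
qed

text \<open>The \<open>e i\<close> behave like a frame of the tangent spaces near \<open>p\<close> and the \<open>f i\<close> like coordinates, but
all of them are global. Linear data on vector fields or one-forms can thereby be expanded near \<open>p\<close>
without localising the algebra of functions. The index \<open>None\<close> belongs to the
cut-off function, which has a derivative of its own.\<close>

lemma local_frame: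
  obtains I :: "'e option set" and \<rho> f e where "finite I" "\<rho> \<in> SF" "\<rho> p = 1"
    "\<And>i. f i \<in> SF" "\<And>i. e i \<in> VF"
    "\<And>q v g. v \<in> T q \<Longrightarrow> \<rho> q * v g = (\<Sum>i\<in>I. v (f i) * e i q g)"
proof -
  obtain B :: "'e set" where B: "parseval_frame B" using parseval_frame_model by blast
  then have finB: "finite B" by (simp add: parseval_frame_def)
  obtain U \<phi> where U: "(U, \<phi>) \<in> \<A>" "p \<in> U" by (rule chart_around)
  obtain R where R: "R > 0" "cball (\<phi> p) R \<subseteq> \<phi> ` U"
    using chartD(2)[OF U(1)] U(2) open_contains_cball by (metis imageI)
  define c r where "c = \<phi> p" and "r = R / 2"
  have r: "0 < r" "r < R" "cball c R \<subseteq> \<phi> ` U" "cball c r \<subseteq> \<phi> ` U" using R by (auto simp: c_def r_def)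
  define \<psi> where "\<psi> = pull U \<phi> (bump c r)"
  define x where "x = (\<lambda>b. pull U \<phi> (\<lambda>y. bump c r y * (y \<bullet> b)))"
  define e where "e = coord_field U \<phi> c r"
  have pullSF: "pull U \<phi> (\<lambda>y. bump c r y * h y) \<in> SF" if "smooth_on h UNIV" for h
    by (rule smooth_function_pull_bump[OF U(1) r(4,1) open_UNIV subset_UNIV that])
  have "smooth_on (\<lambda>y. 1) (UNIV :: 'e set)" by (auto simp: smooth_on_def intro: Ck_on_const)
  from pullSF[OF this] have psiSF: "\<psi> \<in> SF" by (simp add: \<psi>_def)
  have "smooth_on (\<lambda>y. y \<bullet> b) UNIV" for b :: 'e
    by (auto simp: smooth_on_def intro: Ck_on_linear bounded_linear_inner_left)
  from pullSF[OF this] have xSF: "x b \<in> SF" for b by (simp add: x_def)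
  have eVF: "e b \<in> VF" for b unfolding e_def by (rule coord_field_vector_field[OF U(1) r(1,4)])
  define E0 where "E0 = (\<lambda>m g. \<Sum>b\<in>B. x b m * e b m g)"
  have psip: "\<psi> p \<noteq> 0" using U bump_nonzero_iff[OF r(1), of c c] r(1) by (simp add: \<psi>_def pull_def c_def)
  have E0VF: "E0 \<in> VF" unfolding E0_def by (intro vector_field_sum vector_field_smult xSF eVF)
  \<comment> \<open>A third factor \<open>\<psi>\<close> absorbs the coordinates \<open>\<phi> q \<bullet> b\<close>, which are not global functions, into \<open>x b\<close>.\<close>
  have key: "\<psi> q ^ 3 * v g = (\<Sum>b\<in>B. v (x b) * (\<psi> q * e b q g)) - v \<psi> * E0 q g" if v: "v \<in> T q" for q v g
  proof (cases "g \<in> SF \<and> q \<in> U \<and> dist c (\<phi> q) < r")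
    case True
    have "x b q = \<psi> q * (\<phi> q \<bullet> b)" for b using True by (simp add: x_def \<psi>_def pull_def)
    then have "(\<Sum>b\<in>B. v (x b) * (\<psi> q * e b q g)) - v \<psi> * E0 q g
        = \<psi> q * (\<Sum>b\<in>B. (v (x b) - (\<phi> q \<bullet> b) * v \<psi>) * e b q g)"
      by (simp add: E0_def sum_distrib_left left_diff_distrib sum_subtractf algebra_simps)
    also have "\<dots> = \<psi> q * (\<psi> q ^ 2 * v g)"
      using derivation_in_coordinates[OF U(1) r(1-3) B _ _ v, of g] True
      by (simp add: e_def \<psi>_def x_def)
    finally show ?thesis by (simp add: power3_eq_cube power2_eq_square)
  next
    case False
    have "\<psi> q = 0 \<and> (\<forall>b. x b q = 0)" if "g \<in> SF"
      using False that bump_nonzero_iff[OF r(1), of c "\<phi> q"] by (auto simp: \<psi>_def x_def pull_def)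
    moreover have "e b q g = 0" "v g = 0" if "g \<notin> SF" for b
      using that tangentD(4)[OF vector_field_D(1)[OF eVF]] tangentD(4)[OF v] by auto
    ultimately show ?thesis by (cases "g \<in> SF") (auto simp: E0_def)
  qed
  let ?I = "insert None (Some ` B)"
  let ?k = "1 / \<psi> p ^ 3"
  let ?f = "\<lambda>i. case i of None \<Rightarrow> \<psi> | Some b \<Rightarrow> x b"
  let ?e = "\<lambda>i. case i of None \<Rightarrow> (\<lambda>m g. - ?k * E0 m g) | Some b \<Rightarrow> (\<lambda>m g. (?k * \<psi> m) * e b m g)"
  show thesis
  proof
    show "finite ?I" using finB by simp
    show "(\<lambda>m. ?k * (\<psi> m * (\<psi> m * \<psi> m))) \<in> SF" by (intro smooth_function_cmult smooth_function_mult psiSF)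
    show "?k * (\<psi> p * (\<psi> p * \<psi> p)) = 1" using psip by (simp add: power3_eq_cube)
    show "?f i \<in> SF" for i by (cases i) (auto simp: psiSF xSF)
    show "?e i \<in> VF" for i
    proof (cases i)
      case None
      then show ?thesis using vector_field_smult[OF smooth_function_const[of "- ?k"] E0VF] by simp
    next
      case (Some b)
      then show ?thesis using vector_field_smult[OF smooth_function_cmult[OF psiSF, of ?k] eVF[of b]] by simp
    qed
    fix q v g assume v: "v \<in> T q"
    have "(\<Sum>i\<in>?I. v (?f i) * ?e i q g) = v \<psi> * (- ?k * E0 q g) + (\<Sum>b\<in>B. v (x b) * (?k * \<psi> q * e b q g))"
      using finB by (subst sum.insert) (auto simp: sum.reindex)
    also have "\<dots> = ?k * ((\<Sum>b\<in>B. v (x b) * (\<psi> q * e b q g)) - v \<psi> * E0 q g)"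
      by (simp add: right_diff_distrib sum_distrib_left algebra_simps)
    also have "\<dots> = ?k * (\<psi> q ^ 3 * v g)" by (simp only: key[OF v])
    finally show "?k * (\<psi> q * (\<psi> q * \<psi> q)) * v g = (\<Sum>i\<in>?I. v (?f i) * ?e i q g)"
      by (simp add: power3_eq_cube mult.assoc)
  qed
qed

end

section \<open>Transport of structure along module isomorphisms\<close>

lemma cring_real_ring: "cring real_ring"
proof (intro cringI abelian_groupI comm_monoidI)
  show "\<exists>y\<in>carrier real_ring. y \<oplus>\<^bsub>real_ring\<^esub> x = \<zero>\<^bsub>real_ring\<^esub>" for x
    by (rule bexI[of _ "- x"]) (simp_all add: real_ring_def)
qed (simp_all add: real_ring_def algebra_simps)

text \<open>The module axioms see only four fields of the record, so they pass between record types that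
share these.\<close>

lemma module_cong:
  assumes "Module.module R M" "carrier M' = carrier M" "add M' = add M"
    "ring.zero M' = ring.zero M" "smult M' = smult M"
  shows "Module.module R M'"
proof -
  interpret M: Module.module R M by fact
  show ?thesis
  proof (rule moduleI)
    show "abelian_group M'"
    proof (rule abelian_groupI; unfold assms(2-4))
      show "\<exists>y\<in>carrier M. y \<oplus>\<^bsub>M\<^esub> x = \<zero>\<^bsub>M\<^esub>" if "x \<in> carrier M" for x
        using that M.M.l_neg by blast
    qed (auto simp: M.M.a_assoc intro: M.M.a_comm)
  qed (use assms(2-5) M.smult_l_distr M.smult_r_distr M.smult_assoc1 in \<open>auto intro: M.R.cring_axioms\<close>)
qed

lemma mod_iso_cong:
  assumes "mod_iso R L M \<phi>" "carrier M' = carrier M" "add M' = add M"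
    "ring.zero M' = ring.zero M" "smult M' = smult M"
  shows "mod_iso R L M' \<phi>"
proof -
  have "Module.module R M'"
    using assms(1) by (intro module_cong[OF _ assms(2-5)]) (simp add: mod_iso_def mod_hom_def)
  then show ?thesis using assms by (simp add: mod_iso_def mod_hom_def)
qed

text \<open>All axioms for \<open>L'\<close> are images under \<open>\<phi>\<close> of those for \<open>L\<close>, since every element of \<open>L'\<close> is of the
form \<open>\<phi> x\<close>.\<close>

lemma RA_Lie_algebra_transfer:
  assumes L: "RA_Lie_algebra A L" and iso: "mod_iso A L L' \<phi>"
    and lie: "\<And>x y. x \<in> carrier L \<Longrightarrow> y \<in> carrier L \<Longrightarrow> \<phi> (lie L x y) = lie L' (\<phi> x) (\<phi> y)"
    and act: "\<And>x a. x \<in> carrier L \<Longrightarrow> a \<in> carrier A \<Longrightarrow> act L' (\<phi> x) a = act L x a"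
  shows "RA_Lie_algebra A L'"
proof -
  interpret L: RA_Lie_algebra A L by fact
  interpret M: Module.module A L by (rule L.module)
  interpret M': Module.module A L' using iso by (simp add: mod_iso_def mod_hom_def)
  interpret AA: algebra real_ring A by (rule L.algebra)
  have C: "carrier L' = \<phi> ` carrier L" using iso by (simp add: mod_iso_def bij_betw_def)
  have add: "\<phi> x \<oplus>\<^bsub>L'\<^esub> \<phi> y = \<phi> (x \<oplus>\<^bsub>L\<^esub> y)" if "x \<in> carrier L" "y \<in> carrier L" for x y
    using iso that by (simp add: mod_iso_def mod_hom_def)
  have smult: "a \<odot>\<^bsub>L'\<^esub> \<phi> x = \<phi> (a \<odot>\<^bsub>L\<^esub> x)" if "a \<in> carrier A" "x \<in> carrier L" for a x
    using iso that by (simp add: mod_iso_def mod_hom_def)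
  have zero: "\<zero>\<^bsub>L'\<^esub> = \<phi> \<zero>\<^bsub>L\<^esub>"
  proof -
    have "\<phi> \<zero>\<^bsub>L\<^esub> \<oplus>\<^bsub>L'\<^esub> \<phi> \<zero>\<^bsub>L\<^esub> = \<phi> \<zero>\<^bsub>L\<^esub>" "\<phi> \<zero>\<^bsub>L\<^esub> \<in> carrier L'"
      using add[of "\<zero>\<^bsub>L\<^esub>" "\<zero>\<^bsub>L\<^esub>"] C by auto
    then show ?thesis by (metis M'.M.add.l_cancel_one)
  qed
  have scal: "r \<odot>\<^bsub>A\<^esub> \<one>\<^bsub>A\<^esub> \<in> carrier A" for r
    by (rule AA.smult_closed) (simp_all add: real_ring_def)
  have B: "real_Lie_bracket A L" by (rule L.Lie_bracket)
  have cl: "lie L x y \<in> carrier L" if "x \<in> carrier L" "y \<in> carrier L" for x y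
    using B that by (simp add: real_Lie_bracket_def)
  have acl: "act L x a \<in> carrier A" if "x \<in> carrier L" "a \<in> carrier A" for x a
    using L.act_derivation[OF that(1)] that(2) by (auto simp: real_derivation_def)
  show ?thesis
  proof (rule RA_Lie_algebra.intro)
    show "Module.algebra real_ring A" by (rule L.algebra)
    show "Module.module A L'" by (rule M'.module_axioms)
    show "real_Lie_bracket A L'"
      using B unfolding real_Lie_bracket_def C ball_simps zero real_smult_def
      by (simp add: lie[symmetric] add smult scal cl)
    show "real_derivation A (act L' \<alpha>)" if "\<alpha> \<in> carrier L'" for \<alpha>
    proof -
      obtain x where x: "x \<in> carrier L" "\<alpha> = \<phi> x" using \<open>\<alpha> \<in> carrier L'\<close> unfolding C by blast
      have "r \<odot>\<^bsub>A\<^esub> a \<in> carrier A" if "a \<in> carrier A" for r a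
        using that by (intro AA.smult_closed) (simp_all add: real_ring_def)
      then show ?thesis
        using L.act_derivation[OF x(1)] unfolding real_derivation_def x(2)
        by (auto simp: act x(1) Pi_iff)
    qed
    show "act L' (\<alpha> \<oplus>\<^bsub>L'\<^esub> \<beta>) a = act L' \<alpha> a \<oplus>\<^bsub>A\<^esub> act L' \<beta> a"
      if "\<alpha> \<in> carrier L'" "\<beta> \<in> carrier L'" "a \<in> carrier A" for \<alpha> \<beta> a
      using that by (auto simp: C add act L.act_add)
    show "act L' (lie L' \<alpha> \<beta>) a = act L' \<alpha> (act L' \<beta> a) \<ominus>\<^bsub>A\<^esub> act L' \<beta> (act L' \<alpha> a)"
      if "\<alpha> \<in> carrier L'" "\<beta> \<in> carrier L'" "a \<in> carrier A" for \<alpha> \<beta> a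
      using that by (auto simp: C lie[symmetric] act cl acl L.act_lie)
    show "act L' (a \<odot>\<^bsub>L'\<^esub> \<alpha>) b = a \<otimes>\<^bsub>A\<^esub> act L' \<alpha> b"
      if "a \<in> carrier A" "\<alpha> \<in> carrier L'" "b \<in> carrier A" for a \<alpha> b
      using that by (auto simp: C smult act L.act_smult)
    show "lie L' \<alpha> (a \<odot>\<^bsub>L'\<^esub> \<beta>) = a \<odot>\<^bsub>L'\<^esub> lie L' \<alpha> \<beta> \<oplus>\<^bsub>L'\<^esub> act L' \<alpha> a \<odot>\<^bsub>L'\<^esub> \<beta>"
      if "\<alpha> \<in> carrier L'" "a \<in> carrier A" "\<beta> \<in> carrier L'" for \<alpha> a \<beta>
      using that by (auto simp: C lie[symmetric] smult act cl acl add L.lie_smult)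
  qed
qed

section \<open>The Lie algebra of vector fields\<close>

context manifold
begin

lemma smooth_algebra_algebra: "Module.algebra real_ring (smooth_algebra \<A>)"
proof (rule algebraI)
  show "cring (smooth_algebra \<A>)"
  proof (intro cringI abelian_groupI comm_monoidI)
    show "\<exists>g\<in>carrier (smooth_algebra \<A>). g \<oplus>\<^bsub>smooth_algebra \<A>\<^esub> f = \<zero>\<^bsub>smooth_algebra \<A>\<^esub>"
      if "f \<in> carrier (smooth_algebra \<A>)" for f
      using that smooth_function_cmult[of f "-1"] by (intro bexI[of _ "\<lambda>p. - f p"]) (simp_all add: smooth_algebra_def)
  qed (simp_all add: smooth_algebra_def smooth_function_add smooth_function_mult smooth_function_const algebra_simps)
qed (simp_all add: smooth_algebra_def real_ring_def cring_real_ring[unfolded real_ring_def]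
      smooth_function_cmult algebra_simps)

lemma smooth_algebra_minus:
  assumes "f \<in> SF" "g \<in> SF"
  shows "f \<ominus>\<^bsub>smooth_algebra \<A>\<^esub> g = (\<lambda>p. f p - g p)"
proof -
  interpret algebra real_ring "smooth_algebra \<A>" by (rule smooth_algebra_algebra)
  have "\<ominus>\<^bsub>smooth_algebra \<A>\<^esub> g = (\<lambda>p. - g p)"
    using assms(2) smooth_function_cmult[OF assms(2), of "-1"]
    by (intro M.minus_equality) (simp_all add: smooth_algebra_def)
  then show ?thesis by (simp add: a_minus_def smooth_algebra_def)
qed

lemma vector_field_minus: "X \<in> VF \<Longrightarrow> (\<lambda>p f. - X p f) \<in> VF"
  using vector_field_smult[OF smooth_function_const[of "-1"]] by simp

text \<open>The rules for tangent vectors with the vector field as a fixed head symbol, so that they can be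
used for rewriting.\<close>

lemma vector_field_apply:
  assumes "X \<in> VF"
  shows "f \<in> SF \<Longrightarrow> g \<in> SF \<Longrightarrow> X p (\<lambda>x. f x + g x) = X p f + X p g"
    "f \<in> SF \<Longrightarrow> g \<in> SF \<Longrightarrow> X p (\<lambda>x. f x * g x) = X p f * g p + f p * X p g"
    "f \<in> SF \<Longrightarrow> g \<in> SF \<Longrightarrow> X p (\<lambda>x. f x - g x) = X p f - X p g"
    "f \<in> SF \<Longrightarrow> X p (\<lambda>x. r * f x) = r * X p f"
    "X p (\<lambda>x. r) = 0"
    "f \<notin> SF \<Longrightarrow> X p f = 0"
    "f \<in> SF \<Longrightarrow> (\<lambda>p. X p f) \<in> SF"
  using vector_field_D(1)[OF assms, of p] vector_field_D(2)[OF assms] tangent_diff tangent_const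
  by (auto simp: tangentD)

lemma vector_field_bracket:
  assumes X: "X \<in> VF" and Y: "Y \<in> VF" shows "vf_bracket X Y \<in> VF"
proof -
  have "vf_bracket X Y p \<in> T p" for p
    unfolding vf_bracket_def
    by (rule tangentI) (simp_all add: vector_field_apply[OF X] vector_field_apply[OF Y] smooth_function_add smooth_function_mult algebra_simps)
  then show ?thesis using vector_field_D(2)[OF X] vector_field_D(2)[OF Y] by (simp add: vector_fields_def vf_bracket_def smooth_function_diff)
qed

lemma vector_field_module: "Module.module (smooth_algebra \<A>) (vector_field_algebra \<A>)"
proof (rule moduleI)
  interpret algebra real_ring "smooth_algebra \<A>" by (rule smooth_algebra_algebra)
  show "cring (smooth_algebra \<A>)" by (rule cring_axioms)
  show "abelian_group (vector_field_algebra \<A>)"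
  proof (rule abelian_groupI)
    show "\<exists>Y\<in>carrier (vector_field_algebra \<A>).
        Y \<oplus>\<^bsub>vector_field_algebra \<A>\<^esub> X = \<zero>\<^bsub>vector_field_algebra \<A>\<^esub>"
      if "X \<in> carrier (vector_field_algebra \<A>)" for X
      using that vector_field_minus[of X]
      by (intro bexI[of _ "\<lambda>p f. - X p f"]) (simp_all add: vector_field_algebra_def)
  qed (simp_all add: vector_field_algebra_def vector_field_add vector_field_zero algebra_simps)
qed (simp_all add: vector_field_algebra_def smooth_algebra_def vector_field_smult algebra_simps)

lemma vf_bracket_laws:
  assumes X: "X \<in> VF" and Y: "Y \<in> VF" and Z: "Z \<in> VF"
  shows "vf_bracket (\<lambda>p f. X p f + Y p f) Z = (\<lambda>p f. vf_bracket X Z p f + vf_bracket Y Z p f)"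
    "vf_bracket Z (\<lambda>p f. X p f + Y p f) = (\<lambda>p f. vf_bracket Z X p f + vf_bracket Z Y p f)"
    "vf_bracket (\<lambda>p f. r * X p f) Y = (\<lambda>p f. r * vf_bracket X Y p f)"
    "vf_bracket X (\<lambda>p f. r * Y p f) = (\<lambda>p f. r * vf_bracket X Y p f)"
    "(\<lambda>p f. vf_bracket X (vf_bracket Y Z) p f + vf_bracket Y (vf_bracket Z X) p f
       + vf_bracket Z (vf_bracket X Y) p f) = (\<lambda>p f. 0)"
    "a \<in> SF \<Longrightarrow> vf_bracket X (\<lambda>p f. a p * Y p f) = (\<lambda>p f. a p * vf_bracket X Y p f + X p a * Y p f)"
proof -
  note rules = vector_field_apply[OF X] vector_field_apply[OF Y] vector_field_apply[OF Z] vf_bracket_def smooth_function_diff algebra_simps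
  show "vf_bracket (\<lambda>p f. X p f + Y p f) Z = (\<lambda>p f. vf_bracket X Z p f + vf_bracket Y Z p f)"
  proof (intro ext)
    fix p f show "vf_bracket (\<lambda>p f. X p f + Y p f) Z p f = vf_bracket X Z p f + vf_bracket Y Z p f"
      by (cases "f \<in> SF") (simp_all add: rules)
  qed
  show "vf_bracket Z (\<lambda>p f. X p f + Y p f) = (\<lambda>p f. vf_bracket Z X p f + vf_bracket Z Y p f)"
  proof (intro ext)
    fix p f show "vf_bracket Z (\<lambda>p f. X p f + Y p f) p f = vf_bracket Z X p f + vf_bracket Z Y p f"
      by (cases "f \<in> SF") (simp_all add: rules)
  qed
  show "vf_bracket (\<lambda>p f. r * X p f) Y = (\<lambda>p f. r * vf_bracket X Y p f)"
  proof (intro ext)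
    fix p f show "vf_bracket (\<lambda>p f. r * X p f) Y p f = r * vf_bracket X Y p f"
      by (cases "f \<in> SF") (simp_all add: rules)
  qed
  show "vf_bracket X (\<lambda>p f. r * Y p f) = (\<lambda>p f. r * vf_bracket X Y p f)"
  proof (intro ext)
    fix p f show "vf_bracket X (\<lambda>p f. r * Y p f) p f = r * vf_bracket X Y p f"
      by (cases "f \<in> SF") (simp_all add: rules)
  qed
  show "(\<lambda>p f. vf_bracket X (vf_bracket Y Z) p f + vf_bracket Y (vf_bracket Z X) p f
       + vf_bracket Z (vf_bracket X Y) p f) = (\<lambda>p f. 0)"
  proof (intro ext)
    fix p f show "vf_bracket X (vf_bracket Y Z) p f + vf_bracket Y (vf_bracket Z X) p f
       + vf_bracket Z (vf_bracket X Y) p f = 0"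
      by (cases "f \<in> SF") (simp_all add: rules)
  qed
  assume a: "a \<in> SF"
  show "vf_bracket X (\<lambda>p f. a p * Y p f) = (\<lambda>p f. a p * vf_bracket X Y p f + X p a * Y p f)"
  proof (intro ext)
    fix p f show "vf_bracket X (\<lambda>p f. a p * Y p f) p f = a p * vf_bracket X Y p f + X p a * Y p f"
      by (cases "f \<in> SF") (simp_all add: rules a)
  qed
qed

lemma vector_field_Lie_bracket:
  "real_Lie_bracket (smooth_algebra \<A>) (vector_field_algebra \<A>)"
proof -
  have "vf_bracket X X = (\<lambda>p f. 0)" for X :: "'a vector_field" by (simp add: vf_bracket_def)
  then show ?thesis
    unfolding real_Lie_bracket_def real_smult_def
    by (simp add: vector_field_algebra_def smooth_algebra_def vector_field_bracket vf_bracket_laws)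
qed

lemma vector_field_RA_Lie_algebra: "RA_Lie_algebra (smooth_algebra \<A>) (vector_field_algebra \<A>)"
proof (intro RA_Lie_algebra.intro smooth_algebra_algebra vector_field_module vector_field_Lie_bracket)
  let ?L = "vector_field_algebra \<A>" and ?A = "smooth_algebra \<A>"
  show "real_derivation ?A (act ?L X)" if "X \<in> carrier ?L" for X
    using that
    by (auto simp: real_derivation_def vector_field_algebra_def smooth_algebra_def vector_field_apply[of X])
  show "act ?L (lie ?L X Y) a = act ?L X (act ?L Y a) \<ominus>\<^bsub>?A\<^esub> act ?L Y (act ?L X a)"
    if "X \<in> carrier ?L" "Y \<in> carrier ?L" "a \<in> carrier ?A" for X Y a
  proof -
    have "X \<in> VF" "Y \<in> VF" "a \<in> SF"
      using that by (simp_all add: vector_field_algebra_def smooth_algebra_def)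
    then show ?thesis
      using smooth_algebra_minus[of "\<lambda>p. X p (\<lambda>p. Y p a)" "\<lambda>p. Y p (\<lambda>p. X p a)"]
      by (simp add: vector_field_algebra_def vf_bracket_def vector_field_D(2))
  qed
qed (simp_all add: vector_field_algebra_def smooth_algebra_def vf_bracket_laws)

end

section \<open>Tensoriality and the duality of vector fields and one-forms\<close>

context manifold
begin

abbreviation "OF \<equiv> one_forms \<A>"

text \<open>Read at the point \<open>p\<close>, the local frame expands \<open>v\<close> with constant coefficients \<open>v (f i)\<close>; the same
combination of the global fields \<open>e i\<close> extends it.\<close>

lemma vector_field_through:
  assumes v: "v \<in> T p" obtains X where "X \<in> VF" "X p = v"
proof -
  obtain I :: "'e option set" and \<rho> f e where F: "finite I" "\<rho> \<in> SF" "\<rho> p = 1"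
    "\<And>i. f i \<in> SF" "\<And>i. e i \<in> VF"
    "\<And>q v g. v \<in> T q \<Longrightarrow> \<rho> q * v g = (\<Sum>i\<in>I. v (f i) * e i q g)"
    by (rule local_frame[of p]) blast
  show thesis
  proof
    show "(\<lambda>q g. \<Sum>i\<in>I. v (f i) * e i q g) \<in> VF"
      by (intro vector_field_sum vector_field_smult[OF smooth_function_const] F(5))
    show "(\<lambda>g. \<Sum>i\<in>I. v (f i) * e i p g) = v"
    proof
      fix g show "(\<Sum>i\<in>I. v (f i) * e i p g) = v g"
        using F(6)[OF v, of g] F(3) by simp
    qed
  qed
qed

definition linear_on_vector_fields :: "('a vector_field \<Rightarrow> 'a \<Rightarrow> real) \<Rightarrow> bool" where
  "linear_on_vector_fields \<Phi> \<longleftrightarrow> (\<forall>X\<in>VF. \<Phi> X \<in> SF) \<and>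
     (\<forall>X\<in>VF. \<forall>Y\<in>VF. \<Phi> (\<lambda>p f. X p f + Y p f) = (\<lambda>p. \<Phi> X p + \<Phi> Y p)) \<and>
     (\<forall>a\<in>SF. \<forall>X\<in>VF. \<Phi> (\<lambda>p f. a p * X p f) = (\<lambda>p. a p * \<Phi> X p))"

lemma linear_on_vector_fieldsD:
  assumes "linear_on_vector_fields \<Phi>"
  shows "X \<in> VF \<Longrightarrow> \<Phi> X \<in> SF"
    "X \<in> VF \<Longrightarrow> Y \<in> VF \<Longrightarrow> \<Phi> (\<lambda>p f. X p f + Y p f) = (\<lambda>p. \<Phi> X p + \<Phi> Y p)"
    "a \<in> SF \<Longrightarrow> X \<in> VF \<Longrightarrow> \<Phi> (\<lambda>p f. a p * X p f) = (\<lambda>p. a p * \<Phi> X p)"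
  using assms by (simp_all add: linear_on_vector_fields_def)

lemma linear_on_vector_fields_sum:
  assumes \<Phi>: "linear_on_vector_fields \<Phi>" and "finite I" "\<And>i. i \<in> I \<Longrightarrow> X i \<in> VF"
  shows "\<Phi> (\<lambda>p f. \<Sum>i\<in>I. X i p f) = (\<lambda>p. \<Sum>i\<in>I. \<Phi> (X i) p)"
  using assms(2,3)
proof (induction I rule: finite_induct)
  case empty
  show ?case using linear_on_vector_fieldsD(3)[OF \<Phi> smooth_function_const[of 0] vector_field_zero] by simp
next
  case (insert i I)
  then have "\<Phi> (\<lambda>p f. X i p f + (\<Sum>i\<in>I. X i p f)) = (\<lambda>p. \<Phi> (X i) p + \<Phi> (\<lambda>p f. \<Sum>i\<in>I. X i p f) p)"
    by (intro linear_on_vector_fieldsD(2)[OF \<Phi>] vector_field_sum) auto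
  then show ?case using insert by simp
qed

text \<open>Tensoriality: by the local frame, \<open>\<Phi> Z p = \<Sum>\<^sub>i Z p (f i) \<Phi> (e i) p\<close>, and the right-hand side involves
\<open>Z\<close> only through \<open>Z p\<close>.\<close>

lemma linear_on_vector_fields_pointwise:
  assumes \<Phi>: "linear_on_vector_fields \<Phi>" and XY: "X \<in> VF" "Y \<in> VF" "X p = Y p"
  shows "\<Phi> X p = \<Phi> Y p"
proof -
  obtain I :: "'e option set" and \<rho> f e where F: "finite I" "\<rho> \<in> SF" "\<rho> p = 1"
    "\<And>i. f i \<in> SF" "\<And>i. e i \<in> VF"
    "\<And>q v g. v \<in> T q \<Longrightarrow> \<rho> q * v g = (\<Sum>i\<in>I. v (f i) * e i q g)"
    by (rule local_frame[of p]) blast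
  have "\<Phi> Z p = (\<Sum>i\<in>I. Z p (f i) * \<Phi> (e i) p)" if Z: "Z \<in> VF" for Z
  proof -
    have "(\<lambda>q. \<rho> q * \<Phi> Z q) = \<Phi> (\<lambda>q g. \<rho> q * Z q g)"
      by (rule linear_on_vector_fieldsD(3)[OF \<Phi> F(2) Z, symmetric])
    also have "(\<lambda>q g. \<rho> q * Z q g) = (\<lambda>q g. \<Sum>i\<in>I. Z q (f i) * e i q g)"
      using F(6)[OF vector_field_D(1)[OF Z]] by (intro ext)
    also have "\<Phi> \<dots> = (\<lambda>q. \<Sum>i\<in>I. \<Phi> (\<lambda>q g. Z q (f i) * e i q g) q)"
      by (rule linear_on_vector_fields_sum[OF \<Phi> F(1) vector_field_smult[OF vector_field_D(2)[OF Z F(4)] F(5)]])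
    also have "\<dots> = (\<lambda>q. \<Sum>i\<in>I. Z q (f i) * \<Phi> (e i) q)"
      by (simp only: linear_on_vector_fieldsD(3)[OF \<Phi> vector_field_D(2)[OF Z F(4)] F(5)])
    finally have "\<rho> p * \<Phi> Z p = (\<Sum>i\<in>I. Z p (f i) * \<Phi> (e i) p)" by (rule fun_cong)
    then show ?thesis using F(3) by simp
  qed
  then show ?thesis using XY by simp
qed

lemma one_form_D:
  assumes "\<alpha> \<in> OF"
  shows "v \<in> T p \<Longrightarrow> w \<in> T p \<Longrightarrow> \<alpha> p (\<lambda>f. v f + w f) = \<alpha> p v + \<alpha> p w"
    "v \<in> T p \<Longrightarrow> \<alpha> p (\<lambda>f. r * v f) = r * \<alpha> p v"
    "v \<notin> T p \<Longrightarrow> \<alpha> p v = 0"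
    "X \<in> VF \<Longrightarrow> pairing \<alpha> X \<in> SF"
proof -
  have "\<alpha> p \<in> cotangent_space \<A> p" using assms by (simp add: one_forms_def)
  then show "v \<in> T p \<Longrightarrow> w \<in> T p \<Longrightarrow> \<alpha> p (\<lambda>f. v f + w f) = \<alpha> p v + \<alpha> p w"
    "v \<in> T p \<Longrightarrow> \<alpha> p (\<lambda>f. r * v f) = r * \<alpha> p v" "v \<notin> T p \<Longrightarrow> \<alpha> p v = 0"
    unfolding cotangent_space_def by blast+
  show "X \<in> VF \<Longrightarrow> pairing \<alpha> X \<in> SF" using assms by (simp add: one_forms_def)
qed

lemma one_form_I:
  assumes "\<And>p v w. v \<in> T p \<Longrightarrow> w \<in> T p \<Longrightarrow> \<alpha> p (\<lambda>f. v f + w f) = \<alpha> p v + \<alpha> p w"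
    "\<And>p r v. v \<in> T p \<Longrightarrow> \<alpha> p (\<lambda>f. r * v f) = r * \<alpha> p v"
    "\<And>p v. v \<notin> T p \<Longrightarrow> \<alpha> p v = 0"
    "\<And>X. X \<in> VF \<Longrightarrow> (\<lambda>p. \<alpha> p (X p)) \<in> SF"
  shows "\<alpha> \<in> OF"
  using assms by (simp add: one_forms_def cotangent_space_def pairing_def)

lemma pairing_linear_on_vector_fields:
  assumes "\<alpha> \<in> OF" shows "linear_on_vector_fields (pairing \<alpha>)"
  using one_form_D[OF assms] vector_field_D(1) by (simp add: linear_on_vector_fields_def pairing_def)

lemma one_form_eqI:
  assumes "\<alpha> \<in> OF" "\<beta> \<in> OF" "\<And>X. X \<in> VF \<Longrightarrow> pairing \<alpha> X = pairing \<beta> X"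
  shows "\<alpha> = \<beta>"
proof (intro ext)
  fix p v show "\<alpha> p v = \<beta> p v"
  proof (cases "v \<in> T p")
    case True
    then obtain X where "X \<in> VF" "X p = v" by (rule vector_field_through)
    then show ?thesis using fun_cong[OF assms(3), of X p] by (simp add: pairing_def)
  qed (simp add: one_form_D(3) assms)
qed

text \<open>By tensoriality \<open>\<Phi> X p\<close> is a function of \<open>X p\<close>, and every tangent vector at \<open>p\<close> occurs as \<open>X p\<close>.
This is the existence and uniqueness behind the definite descriptions of the adjoint and of the Lie
derivative.\<close>

lemma one_form_represents:
  assumes \<Phi>: "linear_on_vector_fields \<Phi>"
  shows "\<exists>!\<alpha>. \<alpha> \<in> OF \<and> (\<forall>X\<in>VF. pairing \<alpha> X = \<Phi> X)"
proof (rule ex_ex1I)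
  define \<alpha> where "\<alpha> p v = (if v \<in> T p then \<Phi> (SOME X. X \<in> VF \<and> X p = v) p else 0)" for p v
  have val: "\<alpha> p (X p) = \<Phi> X p" if "X \<in> VF" for X p
  proof -
    have "\<exists>Y. Y \<in> VF \<and> Y p = X p" using that by blast
    then have "(SOME Y. Y \<in> VF \<and> Y p = X p) \<in> VF" "(SOME Y. Y \<in> VF \<and> Y p = X p) p = X p"
      by (metis (mono_tags, lifting) someI_ex)+
    then show ?thesis using linear_on_vector_fields_pointwise[OF \<Phi> _ that] vector_field_D(1)[OF that] by (simp add: \<alpha>_def)
  qed
  have "\<alpha> \<in> OF"
  proof (rule one_form_I)
    fix p v w assume vw: "v \<in> T p" "w \<in> T p"
    obtain X Y where X: "X \<in> VF" "X p = v" and Y: "Y \<in> VF" "Y p = w"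
      using vw vector_field_through by metis
    have "\<Phi> (\<lambda>p f. X p f + Y p f) p = \<Phi> X p + \<Phi> Y p"
      by (simp add: linear_on_vector_fieldsD(2)[OF \<Phi> X(1) Y(1)])
    then show "\<alpha> p (\<lambda>f. v f + w f) = \<alpha> p v + \<alpha> p w"
      using val[OF vector_field_add[OF X(1) Y(1)], of p] val[OF X(1), of p] val[OF Y(1), of p] X(2) Y(2) by simp
  next
    fix p r v assume v: "v \<in> T p"
    obtain X where X: "X \<in> VF" "X p = v" using v vector_field_through by metis
    have rX: "(\<lambda>p f. r * X p f) \<in> VF" by (rule vector_field_smult[OF smooth_function_const X(1)])
    have "\<Phi> (\<lambda>p f. r * X p f) p = r * \<Phi> X p"
      by (simp add: linear_on_vector_fieldsD(3)[OF \<Phi> smooth_function_const X(1)])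
    then show "\<alpha> p (\<lambda>f. r * v f) = r * \<alpha> p v"
      using val[OF rX, of p] val[OF X(1), of p] X(2) by simp
  next
    fix X assume "X \<in> VF"
    then show "(\<lambda>p. \<alpha> p (X p)) \<in> SF" using \<Phi> by (simp add: val linear_on_vector_fields_def)
  qed (simp add: \<alpha>_def)
  then show "\<exists>\<alpha>. \<alpha> \<in> OF \<and> (\<forall>X\<in>VF. pairing \<alpha> X = \<Phi> X)"
    using val by (intro exI[of _ \<alpha>]) (simp add: pairing_def)
  fix \<alpha> \<beta> assume "\<alpha> \<in> OF \<and> (\<forall>X\<in>VF. pairing \<alpha> X = \<Phi> X)" "\<beta> \<in> OF \<and> (\<forall>X\<in>VF. pairing \<beta> X = \<Phi> X)"
  then show "\<alpha> = \<beta>" by (intro one_form_eqI) auto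
qed

lemma one_form_add: "\<alpha> \<in> OF \<Longrightarrow> \<beta> \<in> OF \<Longrightarrow> (\<lambda>p v. \<alpha> p v + \<beta> p v) \<in> OF"
  using one_form_D(4)[of \<alpha>] one_form_D(4)[of \<beta>]
  by (intro one_form_I) (simp_all add: one_form_D(1-3) pairing_def smooth_function_add algebra_simps)

lemma one_form_smult: "a \<in> SF \<Longrightarrow> \<alpha> \<in> OF \<Longrightarrow> (\<lambda>p v. a p * \<alpha> p v) \<in> OF"
  using one_form_D(4)[of \<alpha>] by (intro one_form_I) (simp_all add: one_form_D(1-3) pairing_def smooth_function_mult algebra_simps)

lemma one_form_zero: "(\<lambda>p v. 0) \<in> OF"
  by (rule one_form_I) (simp_all add: smooth_function_const)

lemma one_form_sum: "(\<And>i. i \<in> I \<Longrightarrow> \<alpha> i \<in> OF) \<Longrightarrow> (\<lambda>p v. \<Sum>i\<in>I. \<alpha> i p v) \<in> OF"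
proof (induction I rule: infinite_finite_induct)
  case (insert i I)
  then show ?case using one_form_add[of "\<alpha> i"] by simp
qed (simp_all add: one_form_zero)

lemma one_form_differential: "f \<in> SF \<Longrightarrow> differential \<A> f \<in> OF"
  by (rule one_form_I) (simp_all add: differential_def tangent_add tangent_scale vector_field_D)

lemma pairing_differential: "X \<in> VF \<Longrightarrow> pairing (differential \<A> f) X = (\<lambda>p. X p f)"
  by (simp add: pairing_def differential_def vector_field_D(1))

definition linear_on_one_forms :: "('a one_form \<Rightarrow> 'a \<Rightarrow> real) \<Rightarrow> bool" where
  "linear_on_one_forms \<Phi> \<longleftrightarrow>
     (\<forall>\<alpha>\<in>OF. \<forall>\<beta>\<in>OF. \<Phi> (\<lambda>p v. \<alpha> p v + \<beta> p v) = (\<lambda>p. \<Phi> \<alpha> p + \<Phi> \<beta> p)) \<and>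
     (\<forall>a\<in>SF. \<forall>\<alpha>\<in>OF. \<Phi> (\<lambda>p v. a p * \<alpha> p v) = (\<lambda>p. a p * \<Phi> \<alpha> p))"

lemma linear_on_one_formsD:
  assumes "linear_on_one_forms \<Phi>"
  shows "\<alpha> \<in> OF \<Longrightarrow> \<beta> \<in> OF \<Longrightarrow> \<Phi> (\<lambda>p v. \<alpha> p v + \<beta> p v) = (\<lambda>p. \<Phi> \<alpha> p + \<Phi> \<beta> p)"
    "a \<in> SF \<Longrightarrow> \<alpha> \<in> OF \<Longrightarrow> \<Phi> (\<lambda>p v. a p * \<alpha> p v) = (\<lambda>p. a p * \<Phi> \<alpha> p)"
  using assms by (simp_all add: linear_on_one_forms_def)

lemma linear_on_one_forms_sum:
  assumes \<Phi>: "linear_on_one_forms \<Phi>" and "finite I" "\<And>i. i \<in> I \<Longrightarrow> \<alpha> i \<in> OF"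
  shows "\<Phi> (\<lambda>p v. \<Sum>i\<in>I. \<alpha> i p v) = (\<lambda>p. \<Sum>i\<in>I. \<Phi> (\<alpha> i) p)"
  using assms(2,3)
proof (induction I rule: finite_induct)
  case empty
  show ?case using linear_on_one_formsD(2)[OF \<Phi> smooth_function_const[of 0] one_form_zero] by simp
next
  case (insert i I)
  then have "\<Phi> (\<lambda>p v. \<alpha> i p v + (\<Sum>i\<in>I. \<alpha> i p v)) = (\<lambda>p. \<Phi> (\<alpha> i) p + \<Phi> (\<lambda>p v. \<Sum>i\<in>I. \<alpha> i p v) p)"
    by (intro linear_on_one_formsD(1)[OF \<Phi>] one_form_sum) auto
  then show ?case using insert by simp
qed

text \<open>Dually to the expansion of vector fields, \<open>\<rho> \<alpha> = \<Sum>\<^sub>i \<alpha>(e\<^sub>i) df\<^sub>i\<close>: differentials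
generate the one-forms near each point.\<close>

lemma linear_on_one_forms_determined_by_exact:
  assumes \<Phi>: "linear_on_one_forms \<Phi>" and \<Psi>: "linear_on_one_forms \<Psi>" and \<alpha>: "\<alpha> \<in> OF"
    and eq: "\<And>f. f \<in> SF \<Longrightarrow> \<Phi> (differential \<A> f) = \<Psi> (differential \<A> f)"
  shows "\<Phi> \<alpha> = \<Psi> \<alpha>"
proof
  fix p
  obtain I :: "'e option set" and \<rho> f e where F: "finite I" "\<rho> \<in> SF" "\<rho> p = 1"
    "\<And>i. f i \<in> SF" "\<And>i. e i \<in> VF"
    "\<And>q v g. v \<in> T q \<Longrightarrow> \<rho> q * v g = (\<Sum>i\<in>I. v (f i) * e i q g)"
    by (rule local_frame[of p]) blast
  let ?a = "\<lambda>i. pairing \<alpha> (e i)" and ?d = "\<lambda>i. differential \<A> (f i)"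
  have aSF: "?a i \<in> SF" for i using one_form_D(4)[OF \<alpha> F(5)] .
  have dOF: "?d i \<in> OF" for i using one_form_differential[OF F(4)] .
  have expand: "(\<lambda>q v. \<rho> q * \<alpha> q v) = (\<lambda>q v. \<Sum>i\<in>I. ?a i q * ?d i q v)"
  proof (rule one_form_eqI)
    show "(\<lambda>q v. \<rho> q * \<alpha> q v) \<in> OF" by (rule one_form_smult[OF F(2) \<alpha>])
    show "(\<lambda>q v. \<Sum>i\<in>I. ?a i q * ?d i q v) \<in> OF" by (intro one_form_sum one_form_smult aSF dOF)
    fix X assume X: "X \<in> VF"
    have lin: "linear_on_vector_fields (pairing \<alpha>)" by (rule pairing_linear_on_vector_fields[OF \<alpha>])
    have "pairing \<alpha> (\<lambda>q g. \<rho> q * X q g) = pairing \<alpha> (\<lambda>q g. \<Sum>i\<in>I. X q (f i) * e i q g)"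
      using F(6)[OF vector_field_D(1)[OF X]] by (intro arg_cong[where f = "pairing \<alpha>"] ext)
    also have "\<dots> = (\<lambda>q. \<Sum>i\<in>I. pairing \<alpha> (\<lambda>q g. X q (f i) * e i q g) q)"
      by (rule linear_on_vector_fields_sum[OF lin F(1) vector_field_smult[OF vector_field_D(2)[OF X F(4)] F(5)]])
    also have "\<dots> = (\<lambda>q. \<Sum>i\<in>I. X q (f i) * ?a i q)"
      using vector_field_D(1)[OF F(5)] by (simp add: pairing_def one_form_D(2)[OF \<alpha>])
    finally have "pairing \<alpha> (\<lambda>q g. \<rho> q * X q g) = (\<lambda>q. \<Sum>i\<in>I. X q (f i) * ?a i q)" .
    then show "pairing (\<lambda>q v. \<rho> q * \<alpha> q v) X = pairing (\<lambda>q v. \<Sum>i\<in>I. ?a i q * ?d i q v) X"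
      using vector_field_D(1)[OF X] by (simp add: pairing_def one_form_D(2)[OF \<alpha>] differential_def mult.commute)
  qed
  have "\<Theta> \<alpha> p = (\<Sum>i\<in>I. ?a i p * \<Theta> (?d i) p)" if \<Theta>: "linear_on_one_forms \<Theta>" for \<Theta>
  proof -
    have "(\<lambda>q. \<rho> q * \<Theta> \<alpha> q) = \<Theta> (\<lambda>q v. \<rho> q * \<alpha> q v)"
      by (rule linear_on_one_formsD(2)[OF \<Theta> F(2) \<alpha>, symmetric])
    also have "\<dots> = \<Theta> (\<lambda>q v. \<Sum>i\<in>I. ?a i q * ?d i q v)" by (simp only: expand)
    also have "\<dots> = (\<lambda>q. \<Sum>i\<in>I. \<Theta> (\<lambda>q v. ?a i q * ?d i q v) q)"
      by (rule linear_on_one_forms_sum[OF \<Theta> F(1) one_form_smult[OF aSF dOF]])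
    also have "\<dots> = (\<lambda>q. \<Sum>i\<in>I. ?a i q * \<Theta> (?d i) q)"
      by (simp only: linear_on_one_formsD(2)[OF \<Theta> aSF dOF])
    finally have "\<rho> p * \<Theta> \<alpha> p = (\<Sum>i\<in>I. ?a i p * \<Theta> (?d i) p)" by (rule fun_cong)
    then show ?thesis using F(3) by simp
  qed
  from this[OF \<Phi>] this[OF \<Psi>] show "\<Phi> \<alpha> p = \<Psi> \<alpha> p" using eq[OF F(4)] by simp
qed

lemma Lie_derivative:
  assumes X: "X \<in> VF" and \<beta>: "\<beta> \<in> OF"
  shows "Lie_derivative \<A> X \<beta> \<in> OF"
    "Z \<in> VF \<Longrightarrow> pairing (Lie_derivative \<A> X \<beta>) Z = (\<lambda>p. X p (pairing \<beta> Z) - pairing \<beta> (vf_bracket X Z) p)"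
proof -
  let ?\<Phi> = "\<lambda>Z p. X p (pairing \<beta> Z) - pairing \<beta> (vf_bracket X Z) p"
  have lin: "linear_on_vector_fields (pairing \<beta>)" by (rule pairing_linear_on_vector_fields[OF \<beta>])
  note rules = vf_bracket_laws vector_field_bracket vector_field_smult vector_field_D(2)[OF X] vector_field_apply[OF X] smooth_function_diff
    linear_on_vector_fieldsD[OF lin] X
  \<comment> \<open>In \<open>?\<Phi> (a Z)\<close> the two terms \<open>X(a) \<beta>(Z)\<close> cancel.\<close>
  have "linear_on_vector_fields ?\<Phi>"
    unfolding linear_on_vector_fields_def
    by (intro conjI ballI) (simp_all add: rules, simp_all add: algebra_simps)
  from theI'[OF one_form_represents[OF this]]
  have *: "Lie_derivative \<A> X \<beta> \<in> OF \<and> (\<forall>Z\<in>VF. pairing (Lie_derivative \<A> X \<beta>) Z = ?\<Phi> Z)"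
    unfolding Lie_derivative_def fun_eq_iff .
  then show "Lie_derivative \<A> X \<beta> \<in> OF" "Z \<in> VF \<Longrightarrow> pairing (Lie_derivative \<A> X \<beta>) Z = ?\<Phi> Z"
    by auto
qed

end

section \<open>Symplectic manifolds\<close>

locale symplectic_manifold = manifold +
  fixes \<sigma> :: "'a two_form"
  assumes symplectic_form: "symplectic_form \<A> \<sigma>"
begin

lemma sigma_laws:
  assumes "X \<in> VF" "Y \<in> VF"
  shows "\<sigma> X Y \<in> SF"
    "Z \<in> VF \<Longrightarrow> \<sigma> (\<lambda>p f. X p f + Y p f) Z = (\<lambda>p. \<sigma> X Z p + \<sigma> Y Z p)"
    "Z \<in> VF \<Longrightarrow> \<sigma> Z (\<lambda>p f. X p f + Y p f) = (\<lambda>p. \<sigma> Z X p + \<sigma> Z Y p)"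
    "a \<in> SF \<Longrightarrow> \<sigma> (\<lambda>p f. a p * X p f) Y = (\<lambda>p. a p * \<sigma> X Y p)"
    "a \<in> SF \<Longrightarrow> \<sigma> X (\<lambda>p f. a p * Y p f) = (\<lambda>p. a p * \<sigma> X Y p)"
  using symplectic_form assms
  by (simp_all add: symplectic_form_def alternating_form_def smooth_algebra_def vector_field_algebra_def)

lemma sigma_self: "X \<in> VF \<Longrightarrow> \<sigma> X X = (\<lambda>p. 0)"
  using symplectic_form
  by (simp add: symplectic_form_def alternating_form_def smooth_algebra_def vector_field_algebra_def)

text \<open>Polarisation of \<open>\<sigma> (X + Y) (X + Y) = 0\<close>.\<close>

lemma sigma_antisym:
  assumes "X \<in> VF" "Y \<in> VF" shows "\<sigma> X Y p = - \<sigma> Y X p"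
proof -
  have "\<sigma> (\<lambda>p f. X p f + Y p f) (\<lambda>p f. X p f + Y p f) p = 0"
    using sigma_self[OF vector_field_add[OF assms]] by simp
  then show ?thesis
    using assms by (simp add: sigma_laws sigma_self vector_field_add)
qed

lemma flat:
  assumes "X \<in> VF"
  shows "flat \<A> \<sigma> X \<in> OF" "Y \<in> VF \<Longrightarrow> pairing (flat \<A> \<sigma> X) Y = \<sigma> Y X"
proof -
  have "linear_on_vector_fields (\<lambda>Y. \<sigma> Y X)"
    using assms by (simp add: linear_on_vector_fields_def sigma_laws)
  from theI'[OF one_form_represents[OF this]]
  have "flat \<A> \<sigma> X \<in> OF \<and> (\<forall>Y\<in>VF. pairing (flat \<A> \<sigma> X) Y = \<sigma> Y X)"
    unfolding flat_def .
  then show "flat \<A> \<sigma> X \<in> OF" "Y \<in> VF \<Longrightarrow> pairing (flat \<A> \<sigma> X) Y = \<sigma> Y X" by auto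
qed

lemma flat_mod_iso: "mod_iso (smooth_algebra \<A>) (vector_field_algebra \<A>) (one_form_module \<A>) (flat \<A> \<sigma>)"
  using symplectic_form by (simp add: symplectic_form_def)

lemma flat_bij: "bij_betw (flat \<A> \<sigma>) VF OF"
  using flat_mod_iso by (simp add: mod_iso_def vector_field_algebra_def one_form_module_def)

definition unflat :: "'a one_form \<Rightarrow> 'a vector_field" where
  "unflat = inv_into VF (flat \<A> \<sigma>)"

lemma unflat:
  "\<alpha> \<in> OF \<Longrightarrow> unflat \<alpha> \<in> VF" "\<alpha> \<in> OF \<Longrightarrow> flat \<A> \<sigma> (unflat \<alpha>) = \<alpha>" "X \<in> VF \<Longrightarrow> unflat (flat \<A> \<sigma> X) = X"
  using flat_bij unfolding unflat_def
  by (auto simp: bij_betw_def inv_into_into f_inv_into_f)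

lemma unflat_linear:
  assumes "\<alpha> \<in> OF"
  shows "\<beta> \<in> OF \<Longrightarrow> unflat (\<lambda>p v. \<alpha> p v + \<beta> p v) = (\<lambda>p f. unflat \<alpha> p f + unflat \<beta> p f)"
    "a \<in> SF \<Longrightarrow> unflat (\<lambda>p v. a p * \<alpha> p v) = (\<lambda>p f. a p * unflat \<alpha> p f)"
proof -
  have flat_add: "flat \<A> \<sigma> (\<lambda>p f. X p f + Y p f) = (\<lambda>p v. flat \<A> \<sigma> X p v + flat \<A> \<sigma> Y p v)"
    if "X \<in> VF" "Y \<in> VF" for X Y
    using flat_mod_iso that by (simp add: mod_iso_def mod_hom_def vector_field_algebra_def one_form_module_def)
  have flat_smult: "flat \<A> \<sigma> (\<lambda>p f. a p * X p f) = (\<lambda>p v. a p * flat \<A> \<sigma> X p v)"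
    if "a \<in> SF" "X \<in> VF" for a X
    using flat_mod_iso that
    by (simp add: mod_iso_def mod_hom_def vector_field_algebra_def one_form_module_def smooth_algebra_def)
  show "unflat (\<lambda>p v. \<alpha> p v + \<beta> p v) = (\<lambda>p f. unflat \<alpha> p f + unflat \<beta> p f)" if "\<beta> \<in> OF"
    using unflat(3)[OF vector_field_add[OF unflat(1)[OF assms] unflat(1)[OF that]]]
    by (simp add: flat_add unflat assms that)
  show "unflat (\<lambda>p v. a p * \<alpha> p v) = (\<lambda>p f. a p * unflat \<alpha> p f)" if "a \<in> SF"
    using unflat(3)[OF vector_field_smult[OF that unflat(1)[OF assms]]]
    by (simp add: flat_smult unflat assms that)
qed

abbreviation "P \<equiv> poisson_bracket \<A> \<sigma>"

text \<open>The right-hand side is one alternating form with the prescribed values on differentials, and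
there is only one such form: two of them are compared in one argument after the other.\<close>

lemma poisson_tensor:
  assumes "\<alpha> \<in> OF" "\<beta> \<in> OF"
  shows "poisson_tensor \<A> P \<alpha> \<beta> = \<sigma> (unflat \<alpha>) (unflat \<beta>)"
proof -
  define tens where "tens \<pi> \<longleftrightarrow> alternating_form (smooth_algebra \<A>) (one_form_module \<A>) \<pi> \<and>
     (\<forall>f\<in>SF. \<forall>g\<in>SF. \<pi> (differential \<A> f) (differential \<A> g) = P f g)" for \<pi>
  let ?\<pi> = "\<lambda>\<alpha> \<beta>. \<sigma> (unflat \<alpha>) (unflat \<beta>)"
  have lin: "linear_on_one_forms (\<lambda>\<alpha>. \<pi> \<alpha> \<beta>)" "linear_on_one_forms (\<pi> \<beta>)" if "tens \<pi>" "\<beta> \<in> OF" for \<pi> \<beta>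
    using that
    by (simp_all add: tens_def alternating_form_def linear_on_one_forms_def one_form_module_def smooth_algebra_def)
  have tens: "tens ?\<pi>"
    unfolding tens_def alternating_form_def
    by (simp add: smooth_algebra_def one_form_module_def unflat unflat_linear sigma_laws sigma_self
        poisson_bracket_def hamiltonian_field_def flip: unflat_def)
  have "poisson_tensor \<A> P = (SOME \<pi>. tens \<pi>)" by (simp only: poisson_tensor_def tens_def)
  then have "tens (poisson_tensor \<A> P)" using someI[of tens, OF tens] by simp
  note lin' = lin[OF this] lin[OF tens]
  have "poisson_tensor \<A> P (differential \<A> f) (differential \<A> g) = ?\<pi> (differential \<A> f) (differential \<A> g)"
    if "f \<in> SF" "g \<in> SF" for f g
    using \<open>tens (poisson_tensor \<A> P)\<close> tens that by (simp add: tens_def)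
  then have "poisson_tensor \<A> P \<alpha> (differential \<A> g) = ?\<pi> \<alpha> (differential \<A> g)" if "g \<in> SF" for g
    using linear_on_one_forms_determined_by_exact[OF lin'(1)[OF one_form_differential[OF that]] lin'(3)[OF one_form_differential[OF that]] assms(1)]
      that by blast
  then show ?thesis
    using linear_on_one_forms_determined_by_exact[OF lin'(2)[OF assms(1)] lin'(4)[OF assms(1)] assms(2)] by blast
qed

text \<open>The value of \<open>\<beta>\<close> on \<open>\<flat>\<^sup>-\<^sup>1 \<alpha>\<close> is \<open>\<sigma>(\<flat>\<^sup>-\<^sup>1 \<alpha>, \<flat>\<^sup>-\<^sup>1 \<beta>)\<close>, by the definition of \<open>\<flat>\<close>. Uniqueness: the differentials
alone already determine a vector field.\<close>

lemma sharp:
  assumes \<alpha>: "\<alpha> \<in> OF" shows "sharp \<A> P \<alpha> = unflat \<alpha>"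
  unfolding sharp_def
proof (rule the_equality)
  have "pairing \<beta> (unflat \<alpha>) = poisson_tensor \<A> P \<alpha> \<beta>" if \<beta>: "\<beta> \<in> OF" for \<beta>
    using flat(2)[OF unflat(1)[OF \<beta>] unflat(1)[OF \<alpha>]] by (simp add: unflat(2)[OF \<beta>] poisson_tensor[OF \<alpha> \<beta>])
  then show *: "unflat \<alpha> \<in> VF \<and> (\<forall>\<beta>\<in>OF. pairing \<beta> (unflat \<alpha>) = poisson_tensor \<A> P \<alpha> \<beta>)"
    using unflat(1)[OF \<alpha>] by blast
  fix X assume X: "X \<in> VF \<and> (\<forall>\<beta>\<in>OF. pairing \<beta> X = poisson_tensor \<A> P \<alpha> \<beta>)"
  show "X = unflat \<alpha>"
  proof (intro ext)
    fix p f show "X p f = unflat \<alpha> p f"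
    proof (cases "f \<in> SF")
      case True
      then have "pairing (differential \<A> f) X = pairing (differential \<A> f) (unflat \<alpha>)"
        using X * one_form_differential by simp
      then show ?thesis using X * by (simp add: pairing_differential fun_eq_iff)
    next
      case False
      then show ?thesis using vector_field_apply(6) X unflat(1)[OF \<alpha>] by metis
    qed
  qed
qed

text \<open>Evaluated at a vector field \<open>Z\<close>, the difference of the two sides is \<open>d\<sigma>(X, Y, Z)\<close> up to sign.\<close>

lemma flat_bracket:
  assumes X: "X \<in> VF" and Y: "Y \<in> VF"
  shows "flat \<A> \<sigma> (vf_bracket X Y) = one_form_bracket \<A> P (flat \<A> \<sigma> X) (flat \<A> \<sigma> Y)"
proof (intro ext)
  fix p v
  let ?b = "flat \<A> \<sigma>"
  have br: "one_form_bracket \<A> P (?b X) (?b Y) p v = Lie_derivative \<A> X (?b Y) p v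
      - Lie_derivative \<A> Y (?b X) p v - differential \<A> (\<sigma> X Y) p v"
    by (simp add: one_form_bracket_def sharp poisson_tensor flat X Y unflat)
  note Lie = Lie_derivative(1)[OF X flat(1)[OF Y]] Lie_derivative(1)[OF Y flat(1)[OF X]]
  show "?b (vf_bracket X Y) p v = one_form_bracket \<A> P (?b X) (?b Y) p v"
  proof (cases "v \<in> T p")
    case True
    then obtain Z where Z: "Z \<in> VF" "Z p = v" by (rule vector_field_through)
    have val: "\<alpha> p v = pairing \<alpha> Z p" for \<alpha> by (simp add: pairing_def Z(2))
    have closed: "X p (\<sigma> Y Z) - Y p (\<sigma> X Z) + Z p (\<sigma> X Y)
        - \<sigma> (vf_bracket X Y) Z p + \<sigma> (vf_bracket X Z) Y p - \<sigma> (vf_bracket Y Z) X p = 0"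
      using symplectic_form X Y Z(1) unfolding symplectic_form_def closed_two_form_def by blast
    have neg: "W p (\<sigma> Z V) = - W p (\<sigma> V Z)" if W: "W \<in> VF" and V: "V \<in> VF" for W V
    proof -
      have "\<sigma> Z V = (\<lambda>q. (-1) * \<sigma> V Z q)" using sigma_antisym[OF Z(1) V] by auto
      then show ?thesis using vector_field_apply(4)[OF W sigma_laws(1)[OF V Z(1)], of p "-1"] by simp
    qed
    have "?b (vf_bracket X Y) p v = - \<sigma> (vf_bracket X Y) Z p"
      using flat(2)[OF vector_field_bracket[OF X Y] Z(1)] sigma_antisym[OF Z(1) vector_field_bracket[OF X Y], of p]
      by (simp add: val)
    moreover have "Lie_derivative \<A> X (?b Y) p v = - X p (\<sigma> Y Z) - \<sigma> (vf_bracket X Z) Y p"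
      unfolding val Lie_derivative(2)[OF X flat(1)[OF Y] Z(1)]
      by (simp add: flat(2)[OF Y] vector_field_bracket X Z(1) neg Y)
    moreover have "Lie_derivative \<A> Y (?b X) p v = - Y p (\<sigma> X Z) - \<sigma> (vf_bracket Y Z) X p"
      unfolding val Lie_derivative(2)[OF Y flat(1)[OF X] Z(1)]
      by (simp add: flat(2)[OF X] vector_field_bracket Y Z(1) neg X)
    moreover have "differential \<A> (\<sigma> X Y) p v = Z p (\<sigma> X Y)"
      using True Z(2) by (simp add: differential_def)
    ultimately show ?thesis using br closed by linarith
  next
    case False
    then show ?thesis
      using br one_form_D(3)[OF flat(1)[OF vector_field_bracket[OF X Y]] False] one_form_D(3)[OF Lie(1) False] one_form_D(3)[OF Lie(2) False]
      by (simp add: differential_def)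
  qed
qed

theorem flat_RA_Lie_iso:
  "RA_Lie_iso (smooth_algebra \<A>) (vector_field_algebra \<A>) (poisson_one_form_algebra \<A> P) (flat \<A> \<sigma>)"
proof -
  let ?L = "vector_field_algebra \<A>" and ?D = "poisson_one_form_algebra \<A> P"
  have iso: "mod_iso (smooth_algebra \<A>) ?L ?D (flat \<A> \<sigma>)"
    by (rule mod_iso_cong[OF flat_mod_iso]) (simp_all add: poisson_one_form_algebra_def)
  have lie: "flat \<A> \<sigma> (lie ?L X Y) = lie ?D (flat \<A> \<sigma> X) (flat \<A> \<sigma> Y)"
    if "X \<in> carrier ?L" "Y \<in> carrier ?L" for X Y
    using that flat_bracket by (simp add: vector_field_algebra_def poisson_one_form_algebra_def)
  have act: "act ?D (flat \<A> \<sigma> X) f = act ?L X f" if "X \<in> carrier ?L" for X f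
    using that by (simp add: vector_field_algebra_def poisson_one_form_algebra_def sharp flat unflat)
  have "RA_Lie_algebra (smooth_algebra \<A>) ?D"
    by (rule RA_Lie_algebra_transfer[OF vector_field_RA_Lie_algebra iso lie act])
  then show ?thesis
    using vector_field_RA_Lie_algebra iso lie act
    by (simp add: RA_Lie_iso_def RA_Lie_hom_def mod_iso_def)
qed

end

theorem proposition3p15:
  fixes \<A> :: "('a::{t2_space, second_countable_topology}, 'e::real_inner) chart set"
    and \<sigma> :: "'a two_form"
  assumes "smooth_manifold \<A>" and "symplectic_form \<A> \<sigma>"
  shows "RA_Lie_iso (smooth_algebra \<A>) (vector_field_algebra \<A>)
           (poisson_one_form_algebra \<A> (poisson_bracket \<A> \<sigma>)) (flat \<A> \<sigma>)"
proof -
  interpret symplectic_manifold \<A> \<sigma>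
    by unfold_locales (fact assms)+
  show ?thesis by (rule flat_RA_Lie_iso)
qed

end
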